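(* Let $f:\Sigma\to\boldsymbol{R}^3_1$ be a mixed type surface, and let $p\in\Sigma$ be a lightlike point of the first kind satisfying $f(p)=0$. Then there exist a local coordinate neighborhood $((U;u,v),\psi)$ of $p$ (with coordinate map $\psi$), a neighborhood $V\subset\boldsymbol{R}^3_1$ of $0$ and a Lorentz motion $\Psi:V\to\Psi(V)$ such that $$\Psi\circ f\circ\psi^{-1}(u,v)=\Bigg(u+uva_1(u)+uv^2a_3(u)+v^3b_1(u,v),\ \ v+u^2a_2(u),\ \ \int_0^u\frac{t\,\big(a_1(t)+2a_2(t)+t\,a_2'(t)\big)}{\sqrt{t^2a_1(t)^2+1}}\,dt+v\sqrt{u^2a_1(u)^2+1}+v^2b_2(u,v)\Bigg),$$ where $a_1,a_2,a_3$ are functions of one variable, $a_2'=da_2/du$, and $b_1,b_2$ are functions of two variables satisfying $b_2(0,0)=1/4$.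
   Context: All objects (including the functions $a_i,b_j$) are smooth. $\boldsymbol{R}^3_1$ is the Lorentz–Minkowski $3$-space with metric $\langle\boldsymbol x,\boldsymbol x\rangle=x^2+y^2-z^2$; a Lorentz motion is the restriction of an isometry of $\boldsymbol{R}^3_1$. The coordinate system is centered at $p$, i.e. $\psi(p)=(0,0)$. A surface is an immersion $f:\Sigma\to\boldsymbol{R}^3_1$ of a connected $2$-manifold; $ds^2=f^*\langle\ ,\ \rangle$ is its first fundamental form. A point is spacelike, timelike or lightlike if $ds^2$ there is positive definite, (non-degenerate) indefinite, or degenerate; $f$ is of mixed type if both the spacelike and timelike point sets are non-empty. $LD$ is the set of lightlike points. In local coordinates $ds^2=E\,du^2+2F\,du\,dv+G\,dv^2$ and $\lambda=EG-F^2$. A lightlike point $p$ is non-degenerate if $d\lambda(p)\neq0$; then near $p$ the set $LD$ is the image of a regular curve $\gamma(t)$, $\gamma(0)=p$. A non-degenerate lightlike point $p$ is of the first kind if $\gamma'(0)$ is linearly independent of the (one-dimensional) null space $\{\boldsymbol v\in T_p\Sigma: ds^2(\boldsymbol v,\cdot)=0\}$. *)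

theory Defs
  imports "HOL-Analysis.Analysis"
begin

section \<open>Smooth maps between open subsets of normed spaces\<close>

text \<open>On an open subset of a finite-dimensional space, having continuous iterated directional
  derivatives up to order \<open>n\<close> is the same as being of class \<open>C\<^sup>n\<close>.  The recursion goes through
  directional derivatives because the total derivative changes the codomain type.\<close>

primrec Ck_on :: "'a::real_normed_vector set \<Rightarrow> ('a \<Rightarrow> 'b::real_normed_vector) \<Rightarrow> nat \<Rightarrow> bool" where
  "Ck_on S f 0 \<longleftrightarrow> continuous_on S f"
| "Ck_on S f (Suc n) \<longleftrightarrow>
     (\<forall>x\<in>S. f differentiable (at x)) \<and> (\<forall>v. Ck_on S (\<lambda>x. frechet_derivative f (at x) v) n)"

text \<open>Only meaningful for open \<open>S\<close>, since derivatives are taken in the ambient space.\<close>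

definition smooth_on :: "'a::real_normed_vector set \<Rightarrow> ('a \<Rightarrow> 'b::real_normed_vector) \<Rightarrow> bool" where
  "smooth_on S f \<longleftrightarrow> (\<forall>n. Ck_on S f n)"


section \<open>Smooth 2-manifolds\<close>

type_synonym 'a chart = "'a set \<times> ('a \<Rightarrow> real \<times> real)"

definition is_chart :: "'a topology \<Rightarrow> 'a chart \<Rightarrow> bool" where
  "is_chart X c \<longleftrightarrow> (case c of (U, \<phi>) \<Rightarrow>
     openin X U \<and> open (\<phi> ` U) \<and>
     homeomorphic_map (subtopology X U) (top_of_set (\<phi> ` U)) \<phi>)"

definition smoothly_compatible :: "'a chart \<Rightarrow> 'a chart \<Rightarrow> bool" where
  "smoothly_compatible c d \<longleftrightarrow> (case (c, d) of ((U, \<phi>), (W, \<psi>)) \<Rightarrow>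
     smooth_on (\<phi> ` (U \<inter> W)) (\<psi> \<circ> inv_into U \<phi>) \<and>
     smooth_on (\<psi> ` (U \<inter> W)) (\<phi> \<circ> inv_into W \<psi>))"

text \<open>\<open>A\<close> is an atlas, not necessarily a maximal one; the charts of the smooth structure it
  generates are those satisfying \<open>coordinate_chart X A\<close>.\<close>

definition smooth_2_manifold :: "'a topology \<Rightarrow> 'a chart set \<Rightarrow> bool" where
  "smooth_2_manifold X A \<longleftrightarrow>
     Hausdorff_space X \<and> second_countable X \<and>
     (\<forall>c\<in>A. is_chart X c) \<and> (\<Union>c\<in>A. fst c) = topspace X \<and>
     (\<forall>c\<in>A. \<forall>d\<in>A. smoothly_compatible c d)"

definition coordinate_chart :: "'a topology \<Rightarrow> 'a chart set \<Rightarrow> 'a chart \<Rightarrow> bool" where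
  "coordinate_chart X A c \<longleftrightarrow> is_chart X c \<and> (\<forall>d\<in>A. smoothly_compatible c d)"


section \<open>Lorentz--Minkowski 3-space\<close>

definition lorentz :: "real^3 \<Rightarrow> real^3 \<Rightarrow> real" where
  "lorentz x y = x$1 * y$1 + x$2 * y$2 - x$3 * y$3"

definition lorentz_isometry :: "(real^3 \<Rightarrow> real^3) \<Rightarrow> bool" where
  "lorentz_isometry \<Phi> \<longleftrightarrow>
     bij \<Phi> \<and> smooth_on UNIV \<Phi> \<and> smooth_on UNIV (inv \<Phi>) \<and>
     (\<forall>x v w. lorentz (frechet_derivative \<Phi> (at x) v) (frechet_derivative \<Phi> (at x) w) = lorentz v w)"

definition lorentz_motion_on :: "(real^3) set \<Rightarrow> (real^3 \<Rightarrow> real^3) \<Rightarrow> bool" where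
  "lorentz_motion_on V \<Psi> \<longleftrightarrow> (\<exists>\<Phi>. lorentz_isometry \<Phi> \<and> (\<forall>x\<in>V. \<Psi> x = \<Phi> x))"


section \<open>The first fundamental form in local coordinates\<close>

text \<open>Here \<open>r\<close> is the coordinate expression of the surface and \<open>q\<close> a point of the coordinate
  domain; tangent vectors are represented by their coordinates in \<open>\<real> \<times> \<real>\<close>.\<close>

definition ds2 :: "(real \<times> real \<Rightarrow> real^3) \<Rightarrow> real \<times> real \<Rightarrow> real \<times> real \<Rightarrow> real \<times> real \<Rightarrow> real" where
  "ds2 r q v w = lorentz (frechet_derivative r (at q) v) (frechet_derivative r (at q) w)"

definition coeff_E :: "(real \<times> real \<Rightarrow> real^3) \<Rightarrow> real \<times> real \<Rightarrow> real" where
  "coeff_E r q = ds2 r q (1, 0) (1, 0)"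

definition coeff_F :: "(real \<times> real \<Rightarrow> real^3) \<Rightarrow> real \<times> real \<Rightarrow> real" where
  "coeff_F r q = ds2 r q (1, 0) (0, 1)"

definition coeff_G :: "(real \<times> real \<Rightarrow> real^3) \<Rightarrow> real \<times> real \<Rightarrow> real" where
  "coeff_G r q = ds2 r q (0, 1) (0, 1)"

definition discriminant :: "(real \<times> real \<Rightarrow> real^3) \<Rightarrow> real \<times> real \<Rightarrow> real" where
  "discriminant r q = coeff_E r q * coeff_G r q - (coeff_F r q)\<^sup>2"

definition null_space :: "(real \<times> real \<Rightarrow> real^3) \<Rightarrow> real \<times> real \<Rightarrow> (real \<times> real) set" where
  "null_space r q = {v. \<forall>w. ds2 r q v w = 0}"

definition positive_definite_at :: "(real \<times> real \<Rightarrow> real^3) \<Rightarrow> real \<times> real \<Rightarrow> bool" where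
  "positive_definite_at r q \<longleftrightarrow> (\<forall>v. v \<noteq> 0 \<longrightarrow> ds2 r q v v > 0)"

definition degenerate_at :: "(real \<times> real \<Rightarrow> real^3) \<Rightarrow> real \<times> real \<Rightarrow> bool" where
  "degenerate_at r q \<longleftrightarrow> (\<exists>v. v \<noteq> 0 \<and> v \<in> null_space r q)"

definition indefinite_at :: "(real \<times> real \<Rightarrow> real^3) \<Rightarrow> real \<times> real \<Rightarrow> bool" where
  "indefinite_at r q \<longleftrightarrow>
     \<not> degenerate_at r q \<and> (\<exists>v. ds2 r q v v > 0) \<and> (\<exists>w. ds2 r q w w < 0)"


section \<open>Surfaces and their lightlike points\<close>

definition immersed_surface :: "'a topology \<Rightarrow> 'a chart set \<Rightarrow> ('a \<Rightarrow> real^3) \<Rightarrow> bool" where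
  "immersed_surface X A f \<longleftrightarrow>
     smooth_2_manifold X A \<and> connected_space X \<and>
     (\<forall>(U, \<phi>)\<in>A. smooth_on (\<phi> ` U) (f \<circ> inv_into U \<phi>) \<and>
        (\<forall>q\<in>\<phi> ` U. inj (frechet_derivative (f \<circ> inv_into U \<phi>) (at q))))"

text \<open>By the chain rule, the conditions below do not depend on the chart around the point, so
  asking for one chart of the atlas is the same as asking for all of them.\<close>

definition spacelike_points :: "'a chart set \<Rightarrow> ('a \<Rightarrow> real^3) \<Rightarrow> 'a set" where
  "spacelike_points A f =
     {p. \<exists>(U, \<phi>)\<in>A. p \<in> U \<and> positive_definite_at (f \<circ> inv_into U \<phi>) (\<phi> p)}"

definition timelike_points :: "'a chart set \<Rightarrow> ('a \<Rightarrow> real^3) \<Rightarrow> 'a set" where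
  "timelike_points A f =
     {p. \<exists>(U, \<phi>)\<in>A. p \<in> U \<and> indefinite_at (f \<circ> inv_into U \<phi>) (\<phi> p)}"

definition lightlike_points :: "'a chart set \<Rightarrow> ('a \<Rightarrow> real^3) \<Rightarrow> 'a set" where
  "lightlike_points A f =
     {p. \<exists>(U, \<phi>)\<in>A. p \<in> U \<and> degenerate_at (f \<circ> inv_into U \<phi>) (\<phi> p)}"

definition mixed_type_surface :: "'a topology \<Rightarrow> 'a chart set \<Rightarrow> ('a \<Rightarrow> real^3) \<Rightarrow> bool" where
  "mixed_type_surface X A f \<longleftrightarrow>
     immersed_surface X A f \<and> spacelike_points A f \<noteq> {} \<and> timelike_points A f \<noteq> {}"

definition nondegenerate_lightlike :: "'a chart set \<Rightarrow> ('a \<Rightarrow> real^3) \<Rightarrow> 'a \<Rightarrow> bool" where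
  "nondegenerate_lightlike A f p \<longleftrightarrow> p \<in> lightlike_points A f \<and>
     (\<exists>(U, \<phi>)\<in>A. p \<in> U \<and>
        frechet_derivative (discriminant (f \<circ> inv_into U \<phi>)) (at (\<phi> p)) \<noteq> (\<lambda>_. 0))"

text \<open>Near a non-degenerate lightlike point the set of lightlike points is the image of a regular
  curve \<open>\<gamma>\<close>, whose direction at \<open>p\<close> is determined by that set.  The null space is a subspace and
  \<open>\<gamma>'(0) \<noteq> 0\<close>, so linear independence from it means not being an element of it.\<close>

definition lightlike_first_kind :: "'a topology \<Rightarrow> 'a chart set \<Rightarrow> ('a \<Rightarrow> real^3) \<Rightarrow> 'a \<Rightarrow> bool" where
  "lightlike_first_kind X A f p \<longleftrightarrow> nondegenerate_lightlike A f p \<and>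
     (\<exists>(U, \<phi>)\<in>A. p \<in> U \<and>
        (\<exists>W \<epsilon> \<gamma>. openin X W \<and> p \<in> W \<and> W \<subseteq> U \<and> \<epsilon> > 0 \<and> \<gamma> 0 = p \<and>
           \<gamma> ` {-\<epsilon><..<\<epsilon>} = lightlike_points A f \<inter> W \<and>
           smooth_on {-\<epsilon><..<\<epsilon>} (\<phi> \<circ> \<gamma>) \<and>
           (\<forall>t\<in>{-\<epsilon><..<\<epsilon>}. vector_derivative (\<phi> \<circ> \<gamma>) (at t) \<noteq> 0) \<and>
           vector_derivative (\<phi> \<circ> \<gamma>) (at 0) \<notin> null_space (f \<circ> inv_into U \<phi>) (\<phi> p)))"

end

theory Submission
  imports Defs
begin

text \<open>Near a point whose tangent plane is lightlike, the surface is the graph of a smooth function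
  \<open>z = h (x, y)\<close>.  Its first fundamental form degenerates exactly where \<open>h\<^sub>x\<^sup>2 + h\<^sub>y\<^sup>2 = 1\<close>, and its
  null direction there projects to the gradient \<open>(h\<^sub>x, h\<^sub>y)\<close>.

  A suitable Lorentz isometry fixes the second-order jet of \<open>h\<close> at the origin as far as needed
  (lemma \<open>lorentz_graph_position\<close>).  The tangent of the lightlike curve is sent to the \<open>x\<close>-axis
  and the null direction to \<open>(0, 1, 1)\<close>; this gives gradient \<open>(0, 1)\<close> and, because the curve is a
  zero set of \<open>1 - h\<^sub>x\<^sup>2 - h\<^sub>y\<^sup>2\<close>, also \<open>h\<^sub>x\<^sub>y = 0\<close>.  That the point is non-degenerate and of the
  first kind means that the discriminant has a non-zero derivative in the null direction, that
  is, \<open>h\<^sub>y\<^sub>y \<noteq> 0\<close>.  A boost along the null direction rescales \<open>h\<^sub>y\<^sub>y\<close> by a cube, so it can be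
  normalized to \<open>1/2\<close> by a real cube root, whatever its sign.

  The implicit function theorem then describes the lightlike curve as \<open>y = \<beta> x\<close> with \<open>\<beta>\<close> vanishing
  to second order, so \<open>\<beta> u = u\<^sup>2 a2 u\<close>, and the null vector with \<open>dy = 1\<close> along it projects to
  \<open>(\<alpha>, 1)\<close> with \<open>\<alpha> u = u a1 u\<close>.  In the coordinates
  \<open>(x, y) = (u + v \<alpha> u, v + \<beta> u)\<close> the height has exactly the required expansion in \<open>v\<close> (lemma
  \<open>graph_normal_form\<close>): the axis values come from integrating the height along the curve, the
  linear coefficient is determined because the vector is null, and the remainder at the origin is
  \<open>h\<^sub>y\<^sub>y / 2 = 1/4\<close>.  Because \<open>x\<close> is affine in \<open>v\<close> in these coordinates, the functions \<open>a3\<close> and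
  \<open>b1\<close> are zero.

  The analytic tools are a calculus of \<open>C\<^sup>n\<close> maps, Hadamard's lemma for dividing smooth functions
  by \<open>v\<close>, and the smoothness of local inverses in the plane.  The hypotheses may refer to
  different charts of the atlas; they are compared through the rule that the discriminant is
  multiplied by the squared Jacobian of a change of charts.\<close>

section \<open>Calculus of \<open>C\<^sup>n\<close> maps\<close>

lemma frechet_derivative_eqI:
  "(f has_derivative f') (at x) \<Longrightarrow> frechet_derivative f (at x) = f'"
  using frechet_derivative_at by metis

lemma Ck_on_subset: "Ck_on S f n \<Longrightarrow> T \<subseteq> S \<Longrightarrow> Ck_on T f n"
  by (induction n arbitrary: f) (auto intro: continuous_on_subset)

lemma Ck_on_cong:
  assumes "open S" "\<And>x. x \<in> S \<Longrightarrow> f x = g x" "Ck_on S f n"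
  shows "Ck_on S g n"
  using assms(2,3)
proof (induction n arbitrary: f g)
  case 0
  then show ?case by (simp cong: continuous_on_cong)
next
  case (Suc n)
  have D: "(g has_derivative frechet_derivative f (at x)) (at x)" if "x \<in> S" for x
  proof (rule has_derivative_transform_within_open[OF _ \<open>open S\<close> that])
    show "(f has_derivative frechet_derivative f (at x)) (at x)"
      using Suc.prems(2) that by (simp add: frechet_derivative_works)
  qed (use Suc.prems(1) in auto)
  have "Ck_on S (\<lambda>x. frechet_derivative g (at x) v) n" for v
  proof (rule Suc.IH)
    show "Ck_on S (\<lambda>x. frechet_derivative f (at x) v) n"
      using Suc.prems(2) by simp
    show "frechet_derivative f (at x) v = frechet_derivative g (at x) v" if "x \<in> S" for x
      using frechet_derivative_eqI[OF D[OF that]] by simp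
  qed
  then show ?case
    using differentiableI[OF D] by simp
qed

lemma Ck_on_SucI:
  assumes "open S" "\<And>x. x \<in> S \<Longrightarrow> (f has_derivative f' x) (at x)" "\<And>v. Ck_on S (\<lambda>x. f' x v) n"
  shows "Ck_on S f (Suc n)"
proof -
  have "Ck_on S (\<lambda>x. frechet_derivative f (at x) v) n" for v
    by (rule Ck_on_cong[OF assms(1) _ assms(3)[of v]])
       (use frechet_derivative_eqI[OF assms(2)] in auto)
  then show ?thesis
    using differentiableI[OF assms(2)] by simp
qed

lemma Ck_on_Suc_derivative:
  "Ck_on S f (Suc n) \<Longrightarrow> x \<in> S \<Longrightarrow> (f has_derivative frechet_derivative f (at x)) (at x)"
  by (simp add: frechet_derivative_works)

lemma Ck_on_Suc_frechet_derivative: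
  "Ck_on S f (Suc n) \<Longrightarrow> Ck_on S (\<lambda>x. frechet_derivative f (at x) v) n"
  by simp

lemma Ck_on_SucD: "Ck_on S f (Suc n) \<Longrightarrow> Ck_on S f n"
proof (induction n arbitrary: f)
  case 0
  then show ?case
    by (auto intro!: continuous_at_imp_continuous_on differentiable_imp_continuous_within)
next
  case (Suc n)
  show ?case
    using Suc.prems Suc.IH by (simp (no_asm_use)) blast
qed

lemma Ck_on_imp_continuous_on: "Ck_on S f n \<Longrightarrow> continuous_on S f"
  by (induction n) (auto dest: Ck_on_SucD simp del: Ck_on.simps(2))

lemma Ck_on_const: "Ck_on S (\<lambda>x. c) n"
  by (induction n arbitrary: c) auto

lemma Ck_on_bounded_linear:
  assumes "open S" "bounded_linear L"
  shows "Ck_on S L n"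
proof (cases n)
  case 0
  then show ?thesis using assms(2) by (simp add: linear_continuous_on)
next
  case (Suc m)
  have "Ck_on S L (Suc m)"
    by (rule Ck_on_SucI[where f' = "\<lambda>x. L"])
       (use assms in \<open>auto intro: bounded_linear_imp_has_derivative Ck_on_const\<close>)
  then show ?thesis by (simp only: Suc)
qed

lemma Ck_on_linear_compose:
  assumes "open S" "bounded_linear L" "Ck_on S f n"
  shows "Ck_on S (\<lambda>x. L (f x)) n"
  using assms(3)
proof (induction n arbitrary: f)
  case 0
  then show ?case
    using bounded_linear.continuous_on[OF assms(2)] by simp
next
  case (Suc n)
  show ?case
  proof (rule Ck_on_SucI[OF assms(1)])
    show "((\<lambda>x. L (f x)) has_derivative (\<lambda>v. L (frechet_derivative f (at x) v))) (at x)"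
      if "x \<in> S" for x
      using bounded_linear.has_derivative[OF assms(2) Ck_on_Suc_derivative[OF Suc.prems that]] .
  qed (use Suc in auto)
qed

lemma Ck_on_add:
  assumes "open S" "Ck_on S f n" "Ck_on S g n"
  shows "Ck_on S (\<lambda>x. f x + g x) n"
  using assms(2,3)
proof (induction n arbitrary: f g)
  case 0
  then show ?case by (simp add: continuous_on_add)
next
  case (Suc n)
  show ?case
    by (rule Ck_on_SucI[OF assms(1)
          has_derivative_add[OF Ck_on_Suc_derivative[OF Suc.prems(1)] Ck_on_Suc_derivative[OF Suc.prems(2)]]])
       (use Suc in auto)
qed

lemma Ck_on_sum:
  assumes "open S" "\<And>i. i \<in> I \<Longrightarrow> Ck_on S (f i) n"
  shows "Ck_on S (\<lambda>x. \<Sum>i\<in>I. f i x) n"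
  using assms(2)
proof (induction I rule: infinite_finite_induct)
  case (insert i I)
  then show ?case using Ck_on_add[OF assms(1), of "f i" n "\<lambda>x. \<Sum>i\<in>I. f i x"] by simp
qed (simp_all add: Ck_on_const)

lemma Ck_on_bilinear:
  assumes "open S" "bounded_bilinear B" "Ck_on S f n" "Ck_on S g n"
  shows "Ck_on S (\<lambda>x. B (f x) (g x)) n"
  using assms(3,4)
proof (induction n arbitrary: f g)
  case 0
  then show ?case using bounded_bilinear.continuous_on[OF assms(2)] by simp
next
  case (Suc n)
  note D = Ck_on_Suc_derivative[OF Suc.prems(1)] Ck_on_Suc_derivative[OF Suc.prems(2)]
  have "Ck_on S (\<lambda>x. B (f x) (frechet_derivative g (at x) v)
                     + B (frechet_derivative f (at x) v) (g x)) n" for v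
    by (intro Ck_on_add[OF assms(1)] Suc.IH Suc.prems[THEN Ck_on_SucD]
          Suc.prems[THEN Ck_on_Suc_frechet_derivative])
  then show ?case
    by (intro Ck_on_SucI[OF assms(1) bounded_bilinear.FDERIV[OF assms(2) D]])
qed

lemmas Ck_on_mult = Ck_on_bilinear[OF _ bounded_bilinear_mult]
lemmas Ck_on_scaleR = Ck_on_bilinear[OF _ bounded_bilinear_scaleR]

lemma Ck_on_Pair:
  assumes "open S" "Ck_on S f n" "Ck_on S g n"
  shows "Ck_on S (\<lambda>x. (f x, g x)) n"
proof -
  have "Ck_on S (\<lambda>x. (f x, 0) + (0, g x)) n"
    by (intro Ck_on_add[OF assms(1)] assms(2,3)
          Ck_on_linear_compose[OF assms(1), where L = "\<lambda>a. (a, 0)"]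
          Ck_on_linear_compose[OF assms(1), where L = "\<lambda>b. (0, b)"]
          bounded_linear_Pair bounded_linear_ident bounded_linear_zero)
  then show ?thesis by simp
qed

text \<open>By the chain rule, the derivative of a composition is a sum of products in which the
  outer map occurs only through its directional derivatives along a fixed basis, so one
  degree of differentiability can be traded for one application of the induction hypothesis.\<close>

lemma Ck_on_compose:
  fixes f :: "'a::real_normed_vector \<Rightarrow> 'b::euclidean_space"
    and g :: "'b \<Rightarrow> 'c::real_normed_vector"
  assumes "open S" "Ck_on S f n" "Ck_on T g n" "f ` S \<subseteq> T"
  shows "Ck_on S (\<lambda>x. g (f x)) n"
  using assms(2,3)
proof (induction n arbitrary: g)
  case 0
  then show ?case
    using continuous_on_compose2[of T g S f] assms(4) by simp
next
  case (Suc n)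
  let ?f' = "\<lambda>x v. frechet_derivative f (at x) v"
  let ?g' = "\<lambda>b v. frechet_derivative g (at b) v"
  have D: "((\<lambda>x. g (f x)) has_derivative (\<lambda>v. \<Sum>b\<in>Basis. (?f' x v \<bullet> b) *\<^sub>R ?g' (f x) b)) (at x)"
    if "x \<in> S" for x
  proof -
    have dg: "(g has_derivative ?g' (f x)) (at (f x))"
      using that assms(4) by (intro Ck_on_Suc_derivative[OF Suc.prems(2)]) auto
    have "((\<lambda>x. g (f x)) has_derivative (\<lambda>v. ?g' (f x) (?f' x v))) (at x)"
      using diff_chain_at[OF Ck_on_Suc_derivative[OF Suc.prems(1) that] dg] by (simp add: o_def)
    moreover have expand: "?g' (f x) w = (\<Sum>b\<in>Basis. (w \<bullet> b) *\<^sub>R ?g' (f x) b)" for w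
    proof -
      have lin: "linear (?g' (f x))" using dg by (rule has_derivative_linear)
      have "?g' (f x) w = ?g' (f x) (\<Sum>b\<in>Basis. (w \<bullet> b) *\<^sub>R b)"
        by (simp add: euclidean_representation)
      also have "\<dots> = (\<Sum>b\<in>Basis. (w \<bullet> b) *\<^sub>R ?g' (f x) b)"
        by (simp add: linear_sum[OF lin] linear_cmul[OF lin])
      finally show ?thesis .
    qed
    ultimately show ?thesis by (subst (asm) expand)
  qed
  have "Ck_on S (\<lambda>x. \<Sum>b\<in>Basis. (?f' x v \<bullet> b) *\<^sub>R ?g' (f x) b) n" for v
  proof (intro Ck_on_sum[OF assms(1)] Ck_on_scaleR[OF assms(1)])
    fix b :: 'b
    show "Ck_on S (\<lambda>x. ?f' x v \<bullet> b) n"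
      by (rule Ck_on_linear_compose[OF assms(1) bounded_linear_inner_left
            Ck_on_Suc_frechet_derivative[OF Suc.prems(1)]])
    show "Ck_on S (\<lambda>x. ?g' (f x) b) n"
      by (rule Suc.IH[OF Ck_on_SucD[OF Suc.prems(1)] Ck_on_Suc_frechet_derivative[OF Suc.prems(2)]])
  qed
  then show ?case
    by (intro Ck_on_SucI[OF assms(1) D])
qed

lemma Ck_on_inverse:
  fixes f :: "'a::real_normed_vector \<Rightarrow> real"
  assumes "open S" "\<And>x. x \<in> S \<Longrightarrow> f x \<noteq> 0" "Ck_on S f n"
  shows "Ck_on S (\<lambda>x. inverse (f x)) n"
  using assms(3)
proof (induction n)
  case 0
  then show ?case using assms(2) by (auto intro: continuous_on_inverse)
next
  case (Suc n)
  have D: "((\<lambda>x. inverse (f x)) has_derivative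
      (\<lambda>v. (- 1) * (inverse (f x) * (inverse (f x) * frechet_derivative f (at x) v)))) (at x)"
    if "x \<in> S" for x
    using Deriv.has_derivative_inverse[OF assms(2)[OF that] Ck_on_Suc_derivative[OF Suc.prems that]]
    by (simp add: mult.assoc mult.commute)
  have "Ck_on S (\<lambda>x. (- 1) * (inverse (f x) * (inverse (f x) * frechet_derivative f (at x) v))) n"
    for v
    by (intro Ck_on_mult[OF assms(1)] Ck_on_const Suc.IH Ck_on_SucD[OF Suc.prems]
          Ck_on_Suc_frechet_derivative[OF Suc.prems])
  then show ?case
    by (intro Ck_on_SucI[OF assms(1) D])
qed


section \<open>Smooth maps\<close>

lemma smooth_on_open_cong:
  "open S \<Longrightarrow> smooth_on S f \<Longrightarrow> (\<And>x. x \<in> S \<Longrightarrow> f x = g x) \<Longrightarrow> smooth_on S g"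
  unfolding smooth_on_def using Ck_on_cong by blast

lemma smooth_on_subset: "smooth_on S f \<Longrightarrow> T \<subseteq> S \<Longrightarrow> smooth_on T f"
  unfolding smooth_on_def using Ck_on_subset by blast

lemma smooth_on_derivative:
  "smooth_on S f \<Longrightarrow> x \<in> S \<Longrightarrow> (f has_derivative frechet_derivative f (at x)) (at x)"
  unfolding smooth_on_def using Ck_on_Suc_derivative by blast

lemma smooth_on_frechet_derivative:
  "smooth_on S f \<Longrightarrow> smooth_on S (\<lambda>x. frechet_derivative f (at x) v)"
  unfolding smooth_on_def by (metis Ck_on.simps(2))

lemma smooth_on_imp_continuous_on: "smooth_on S f \<Longrightarrow> continuous_on S f"
  unfolding smooth_on_def by (metis Ck_on.simps(1))

lemma smooth_on_const: "smooth_on S (\<lambda>x. c)"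
  by (simp add: smooth_on_def Ck_on_const)

lemma smooth_on_bounded_linear: "open S \<Longrightarrow> bounded_linear L \<Longrightarrow> smooth_on S L"
  by (simp add: smooth_on_def Ck_on_bounded_linear)

lemma smooth_on_linear_compose:
  "open S \<Longrightarrow> bounded_linear L \<Longrightarrow> smooth_on S f \<Longrightarrow> smooth_on S (\<lambda>x. L (f x))"
  by (simp add: smooth_on_def Ck_on_linear_compose)

lemma smooth_on_add:
  "open S \<Longrightarrow> smooth_on S f \<Longrightarrow> smooth_on S g \<Longrightarrow> smooth_on S (\<lambda>x. f x + g x)"
  by (simp add: smooth_on_def Ck_on_add)

lemma smooth_on_mult:
  fixes f g :: "'a::real_normed_vector \<Rightarrow> real"
  shows "open S \<Longrightarrow> smooth_on S f \<Longrightarrow> smooth_on S g \<Longrightarrow> smooth_on S (\<lambda>x. f x * g x)"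
  by (simp add: smooth_on_def Ck_on_mult)

lemma smooth_on_diff:
  fixes f g :: "'a::real_normed_vector \<Rightarrow> real"
  assumes "open S" "smooth_on S f" "smooth_on S g"
  shows "smooth_on S (\<lambda>x. f x - g x)"
  using smooth_on_add[OF assms(1,2) smooth_on_mult[OF assms(1) smooth_on_const[of S "- 1"] assms(3)]]
  by simp

lemma smooth_on_power:
  fixes f :: "'a::real_normed_vector \<Rightarrow> real"
  shows "open S \<Longrightarrow> smooth_on S f \<Longrightarrow> smooth_on S (\<lambda>x. f x ^ k)"
  by (induction k) (simp_all add: smooth_on_const smooth_on_mult)

lemma smooth_on_divide:
  fixes f g :: "'a::real_normed_vector \<Rightarrow> real"
  assumes "open S" "smooth_on S f" "smooth_on S g" "\<And>x. x \<in> S \<Longrightarrow> g x \<noteq> 0"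
  shows "smooth_on S (\<lambda>x. f x / g x)"
  unfolding divide_inverse
  using assms by (intro smooth_on_mult) (auto simp: smooth_on_def intro: Ck_on_inverse)

lemma smooth_on_Pair:
  "open S \<Longrightarrow> smooth_on S f \<Longrightarrow> smooth_on S g \<Longrightarrow> smooth_on S (\<lambda>x. (f x, g x))"
  by (simp add: smooth_on_def Ck_on_Pair)

lemma smooth_on_compose:
  fixes f :: "'a::real_normed_vector \<Rightarrow> 'b::euclidean_space"
    and g :: "'b \<Rightarrow> 'c::real_normed_vector"
  shows "open S \<Longrightarrow> smooth_on T g \<Longrightarrow> smooth_on S f \<Longrightarrow> f ` S \<subseteq> T \<Longrightarrow> smooth_on S (\<lambda>x. g (f x))"
  unfolding smooth_on_def using Ck_on_compose by blast

lemma smooth_on_fst: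
  assumes "open S" "smooth_on S f" shows "smooth_on S (\<lambda>x. fst (f x))"
  using smooth_on_linear_compose[OF assms(1) bounded_linear_fst assms(2)] .

lemma smooth_on_snd:
  assumes "open S" "smooth_on S f" shows "smooth_on S (\<lambda>x. snd (f x))"
  using smooth_on_linear_compose[OF assms(1) bounded_linear_snd assms(2)] .

lemma smooth_on_ident: "open S \<Longrightarrow> smooth_on S (\<lambda>x. x)"
  by (rule smooth_on_bounded_linear[OF _ bounded_linear_ident])


section \<open>Hadamard's lemma\<close>

text \<open>Differentiating under the integral sign turns a directional derivative of the
  integral into the integral of a directional derivative, so the class of the integrand is
  inherited by induction.\<close>

lemma Ck_on_parametric_integral:
  fixes F :: "'a::euclidean_space \<times> real \<Rightarrow> real"
  assumes "open S" "convex S" "open T" "S \<times> {0..1} \<subseteq> T" "Ck_on T F n"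
  shows "Ck_on S (\<lambda>x. integral {0..1} (\<lambda>t. F (x, t))) n"
  using assms(5)
proof (induction n arbitrary: F)
  case 0
  then have "continuous_on (S \<times> cbox 0 1) (\<lambda>(x, t). F (x, t))"
    using assms(4) by (auto intro: continuous_on_subset)
  from integral_continuous_on_param[OF this] show ?case by simp
next
  case (Suc n)
  let ?F' = "\<lambda>x t v. frechet_derivative F (at (x, t)) (v, 0)"
  have D: "((\<lambda>x. F (x, t)) has_derivative ?F' x t) (at x)" if "x \<in> S" "t \<in> {0..1}" for x t
  proof -
    have "((\<lambda>x. (x, t)) has_derivative (\<lambda>v. (v, 0))) (at x)"
      by (auto intro!: derivative_eq_intros)
    moreover have "(x, t) \<in> T" using that assms(4) by blast
    ultimately show ?thesis
      using diff_chain_at[OF _ Ck_on_Suc_derivative[OF Suc.prems]] by (fastforce simp: o_def)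
  qed
  have cont: "continuous_on (S \<times> {0..1}) (\<lambda>p. frechet_derivative F (at p) (v, 0))" for v
  proof -
    show ?thesis
      using Ck_on_imp_continuous_on[OF Ck_on_Suc_frechet_derivative[OF Suc.prems]] using assms(4) by (auto intro: continuous_on_subset)
  qed
  define fx where "fx x t = Blinfun (?F' x t)" for x t
  have fx: "blinfun_apply (fx x t) = ?F' x t" if "x \<in> S" "t \<in> {0..1}" for x t
    unfolding fx_def
    by (rule bounded_linear_Blinfun_apply[OF has_derivative_bounded_linear[OF D[OF that]]])
  have cont_fx: "continuous_on (S \<times> cbox 0 1) (\<lambda>(x, t). fx x t)"
  proof (rule continuous_on_blinfun_componentwise)
    fix i :: 'a
    show "continuous_on (S \<times> cbox 0 1) (\<lambda>p. blinfun_apply (case p of (x, t) \<Rightarrow> fx x t) i)"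
      by (rule continuous_on_eq[of _ "\<lambda>p. frechet_derivative F (at p) (i, 0)"])
         (use cont[of i] fx in auto)
  qed
  have int: "(\<lambda>t. F (x, t)) integrable_on cbox 0 1" if "x \<in> S" for x
  proof (rule integrable_continuous)
    show "continuous_on (cbox 0 1) (\<lambda>t. F (x, t))"
      using that assms(4) Ck_on_imp_continuous_on[OF Suc.prems]
      by (auto intro!: continuous_on_compose2[of T F] continuous_intros)
  qed
  have DI: "((\<lambda>x. integral {0..1} (\<lambda>t. F (x, t))) has_derivative
            (\<lambda>v. integral {0..1} (\<lambda>t. ?F' x t v))) (at x)" if "x \<in> S" for x
  proof -
    have "((\<lambda>x. integral (cbox 0 1) (\<lambda>t. F (x, t))) has_derivative
            blinfun_apply (integral (cbox 0 1) (fx x))) (at x within S)"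
      by (rule leibniz_rule[OF _ int cont_fx that assms(2)])
         (use fx D in \<open>auto intro: has_derivative_at_withinI\<close>)
    moreover have "blinfun_apply (integral (cbox 0 1) (fx x))
        = (\<lambda>v. integral {0..1} (\<lambda>t. ?F' x t v))"
    proof
      fix v
      have "fx x integrable_on cbox 0 1"
        by (rule integrable_continuous, rule continuous_on_compose2[OF cont_fx, of _ "Pair x", simplified])
           (use that in \<open>auto intro!: continuous_intros\<close>)
      then have "blinfun_apply (integral (cbox 0 1) (fx x)) v
          = integral (cbox 0 1) (\<lambda>t. blinfun_apply (fx x t) v)"
        by (rule blinfun_apply_integral)
      also have "\<dots> = integral {0..1} (\<lambda>t. ?F' x t v)"
        unfolding cbox_interval
        by (rule Henstock_Kurzweil_Integration.integral_cong) (simp add: fx[OF that])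
      finally show "blinfun_apply (integral (cbox 0 1) (fx x)) v
          = integral {0..1} (\<lambda>t. ?F' x t v)" .
    qed
    ultimately have "((\<lambda>x. integral {0..1} (\<lambda>t. F (x, t))) has_derivative
            (\<lambda>v. integral {0..1} (\<lambda>t. ?F' x t v))) (at x within S)"
      by (simp only: cbox_interval)
    then show ?thesis unfolding at_within_open[OF that assms(1)] .
  qed
  show ?case
    by (rule Ck_on_SucI[OF assms(1) DI])
       (use Suc.IH[OF Ck_on_Suc_frechet_derivative[OF Suc.prems]] in auto)
qed

text \<open>The quotient \<open>g1\<close> is the mean of the \<open>v\<close>-derivative of \<open>g\<close> over the segment from
  \<open>(x, 0)\<close> to \<open>(x, v)\<close>; convexity and invariance under \<open>(x, v) \<mapsto> (x, 0)\<close> keep that segment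
  in \<open>S\<close>.\<close>

lemma hadamard:
  fixes g :: "'a::euclidean_space \<times> real \<Rightarrow> real"
  assumes "open S" "convex S" "smooth_on S g" and proj: "(\<lambda>p. (fst p, 0)) ` S \<subseteq> S"
  obtains g1 where "smooth_on S g1"
    "\<And>x v. (x, v) \<in> S \<Longrightarrow> g (x, v) = g (x, 0) + v * g1 (x, v)"
    "\<And>x. (x, 0) \<in> S \<Longrightarrow> g1 (x, 0) = frechet_derivative g (at (x, 0)) (0, 1)"
proof -
  have S0: "(x, 0) \<in> S" if "(x, v) \<in> S" for x v using proj that by force
  let ?gv = "\<lambda>p. frechet_derivative g (at p) (0, 1)"
  let ?m = "\<lambda>q::('a \<times> real) \<times> real. (fst (fst q), snd (fst q) * snd q)"
  define T where "T = ?m -` S"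
  define g1 where "g1 p = integral {0..1} (\<lambda>t. ?gv (?m (p, t)))" for p
  have "open T"
    unfolding T_def by (rule open_vimage[OF assms(1)]) (intro continuous_intros)
  have segment: "(x, v * t) \<in> S" if "(x, v) \<in> S" "t \<in> {0..1}" for x v t
  proof -
    have "t *\<^sub>R (x, v) + (1 - t) *\<^sub>R (x, 0) \<in> S"
      using that by (intro convexD[OF assms(2)] S0[OF that(1)]) auto
    then show ?thesis by (simp add: scaleR_left_distrib[symmetric] mult.commute)
  qed
  have "smooth_on T (\<lambda>q. ?gv (?m q))"
    using \<open>open T\<close>
    by (intro smooth_on_compose[OF _ smooth_on_frechet_derivative[OF assms(3)]] smooth_on_Pair
        smooth_on_mult smooth_on_fst smooth_on_snd smooth_on_ident) (auto simp: T_def)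
  moreover have "S \<times> {0..1} \<subseteq> T"
    using segment by (auto simp: T_def)
  ultimately have "smooth_on S g1"
    unfolding smooth_on_def g1_def
    using Ck_on_parametric_integral[OF assms(1,2) \<open>open T\<close>] by blast
  moreover have "g (x, v) = g (x, 0) + v * g1 (x, v)" if "(x, v) \<in> S" for x v
  proof -
    have "((\<lambda>t. g (x, v * t)) has_vector_derivative v * ?gv (x, v * t)) (at t within {0..1})"
      if t: "t \<in> {0..1}" for t
    proof -
      note Dg = smooth_on_derivative[OF assms(3) segment[OF \<open>(x, v) \<in> S\<close> t]]
      have "((\<lambda>t. (x, v * t)) has_derivative (\<lambda>h. (0, v * h))) (at t)"
        by (auto intro!: derivative_eq_intros)
      from diff_chain_at[OF this Dg]
      have "((\<lambda>t. g (x, v * t)) has_derivative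
             (\<lambda>h. frechet_derivative g (at (x, v * t)) (0, v * h))) (at t)"
        by (simp add: o_def)
      moreover have "frechet_derivative g (at (x, v * t)) (0, v * h) = h *\<^sub>R (v * ?gv (x, v * t))" for h
        using linear_cmul[OF has_derivative_linear[OF Dg], of "v * h" "(0, 1)"] by (simp add: mult.assoc mult.left_commute)
      ultimately show ?thesis
        unfolding has_vector_derivative_def by (simp add: has_derivative_at_withinI)
    qed
    from fundamental_theorem_of_calculus[OF _ this]
    have "((\<lambda>t. v * ?gv (x, v * t)) has_integral g (x, v) - g (x, 0)) {0..1}" by simp
    from integral_unique[OF this]
    have "v * integral {0..1} (\<lambda>t. ?gv (x, v * t)) = g (x, v) - g (x, 0)"
      unfolding integral_mult_right .
    then show ?thesis by (simp add: g1_def)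
  qed
  moreover have "g1 (x, 0) = ?gv (x, 0)" for x
    by (simp add: g1_def)
  ultimately show ?thesis using that by blast
qed

lemma has_derivative_partial_fst:
  assumes "smooth_on S g" "(x, 0) \<in> S"
  shows "((\<lambda>p. g (fst p, 0::real)) has_derivative (\<lambda>w. frechet_derivative g (at (x, 0)) (fst w, 0))) (at (x, v))"
proof -
  have "((\<lambda>p. (fst p, 0::real)) has_derivative (\<lambda>w. (fst w, 0))) (at (x, v))"
    by (auto intro!: derivative_eq_intros)
  from diff_chain_at[OF this] smooth_on_derivative[OF assms]
  show ?thesis by (fastforce simp: o_def)
qed

text \<open>Hadamard's lemma is applied to \<open>g\<close> and again to the quotient \<open>g1\<close>.  Differentiating
  \<open>g = g (x, 0) + v g1\<close> gives \<open>g\<^sub>v = g1 + v \<partial>\<^sub>v g1\<close>, and a second differentiation at \<open>v = 0\<close>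
  yields \<open>2 \<partial>\<^sub>v g1 = g\<^sub>v\<^sub>v\<close>, which identifies the remainder on the axis.\<close>

lemma taylor_second_order:
  fixes g :: "'a::euclidean_space \<times> real \<Rightarrow> real"
  assumes "open S" "convex S" "smooth_on S g" and proj: "(\<lambda>p. (fst p, 0)) ` S \<subseteq> S"
  obtains g2 where "smooth_on S g2"
    "\<And>x v. (x, v) \<in> S \<Longrightarrow>
       g (x, v) = g (x, 0) + v * frechet_derivative g (at (x, 0)) (0, 1) + v\<^sup>2 * g2 (x, v)"
    "\<And>x. (x, 0) \<in> S \<Longrightarrow>
       2 * g2 (x, 0) = frechet_derivative (\<lambda>p. frechet_derivative g (at p) (0, 1)) (at (x, 0)) (0, 1)"
proof -
  have S0: "(x, 0) \<in> S" if "(x, v) \<in> S" for x v using proj that by force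
  let ?d = "\<lambda>k p. frechet_derivative k (at p) (0 :: 'a, 1 :: real) :: real"
  obtain g1 where g1: "smooth_on S g1"
    "\<And>x v. (x, v) \<in> S \<Longrightarrow> g (x, v) = g (x, 0) + v * g1 (x, v)"
    "\<And>x. (x, 0) \<in> S \<Longrightarrow> g1 (x, 0) = ?d g (x, 0)"
    using hadamard[OF assms] by blast
  obtain g2 where g2: "smooth_on S g2"
    "\<And>x v. (x, v) \<in> S \<Longrightarrow> g1 (x, v) = g1 (x, 0) + v * g2 (x, v)"
    "\<And>x. (x, 0) \<in> S \<Longrightarrow> g2 (x, 0) = ?d g1 (x, 0)"
    using hadamard[OF assms(1,2) g1(1) proj] by blast
  have gv: "?d g p = ?d g1 p * snd p + g1 p" if "p \<in> S" for p
  proof -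
    obtain x v where p: "p = (x, v)" by force
    have "(g has_derivative (\<lambda>w. frechet_derivative g (at (x, 0)) (fst w, 0)
        + (snd p * frechet_derivative g1 (at p) w + snd w * g1 p))) (at p)"
    proof (rule has_derivative_transform_within_open[OF _ assms(1) that])
      show "((\<lambda>q. g (fst q, 0) + snd q * g1 q) has_derivative
        (\<lambda>w. frechet_derivative g (at (x, 0)) (fst w, 0)
          + (snd p * frechet_derivative g1 (at p) w + snd w * g1 p))) (at p)"
        using that S0 unfolding p
        by (intro has_derivative_add has_derivative_mult has_derivative_partial_fst[OF assms(3)]
            smooth_on_derivative[OF g1(1)] has_derivative_snd has_derivative_ident)
    qed (use g1(2) in auto)
    moreover have "frechet_derivative g (at (x, 0)) (0, 0) = 0"
      using linear_0[OF has_derivative_linear[OF smooth_on_derivative[OF assms(3), of "(x, 0)"]]]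
        S0 that p by (auto simp: zero_prod_def)
    ultimately show ?thesis
      using frechet_derivative_eqI by (fastforce simp: mult.commute)
  qed
  have "?d (?d g) (x, 0) = 2 * g2 (x, 0)" if "(x, 0) \<in> S" for x
  proof -
    have "(?d g has_derivative (\<lambda>w. (?d g1 (x, 0) * snd w
        + frechet_derivative (?d g1) (at (x, 0)) w * snd (x, 0::real))
        + frechet_derivative g1 (at (x, 0)) w)) (at (x, 0))"
    proof (rule has_derivative_transform_within_open[OF _ assms(1) that])
      show "((\<lambda>p. ?d g1 p * snd p + g1 p) has_derivative (\<lambda>w. (?d g1 (x, 0) * snd w
        + frechet_derivative (?d g1) (at (x, 0)) w * snd (x, 0::real))
        + frechet_derivative g1 (at (x, 0)) w)) (at (x, 0))"
        using that
        by (intro has_derivative_add has_derivative_mult smooth_on_derivative[OF g1(1)]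
            smooth_on_derivative[OF smooth_on_frechet_derivative[OF g1(1)]]
            has_derivative_snd has_derivative_ident)
    qed (use gv in auto)
    from frechet_derivative_eqI[OF this] show ?thesis using g2(3)[OF that] by simp
  qed
  moreover have "g (x, v) = g (x, 0) + v * ?d g (x, 0) + v\<^sup>2 * g2 (x, v)" if "(x, v) \<in> S" for x v
    using g1(2)[OF that] g1(3)[OF S0[OF that]] g2(2)[OF that]
    by (simp add: algebra_simps power2_eq_square)
  ultimately show ?thesis using that[of g2] g2(1) by simp
qed

lemma smooth_on_real_derivative:
  fixes f :: "real \<Rightarrow> real"
  shows "smooth_on S f \<Longrightarrow> x \<in> S \<Longrightarrow> (f has_real_derivative deriv f x) (at x)"
  using smooth_on_derivative DERIV_deriv_iff_real_differentiable differentiableI by blast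

text \<open>A function of one variable is regarded as a function of two that ignores the first.\<close>

lemma hadamard_real:
  fixes f :: "real \<Rightarrow> real"
  assumes "open I" "is_interval I" "0 \<in> I" "smooth_on I f"
  obtains f1 where "smooth_on I f1" "\<And>u. u \<in> I \<Longrightarrow> f u = f 0 + u * f1 u" "f1 0 = deriv f 0"
proof -
  let ?g = "\<lambda>p::real \<times> real. f (snd p)"
  have "open (UNIV \<times> I :: (real \<times> real) set)" "convex (UNIV \<times> I :: (real \<times> real) set)"
    using assms by (auto intro: open_Times convex_Times simp: is_interval_convex_1)
  note S = this
  have "smooth_on (UNIV \<times> I) ?g"
    using S(1) by (intro smooth_on_compose[OF _ assms(4)] smooth_on_snd smooth_on_ident) auto
  from hadamard[OF S this] obtain g1 where g1: "smooth_on (UNIV \<times> I) g1"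
    "\<And>x v. v \<in> I \<Longrightarrow> f v = f 0 + v * g1 (x, v)"
    "\<And>x. g1 (x, 0) = frechet_derivative ?g (at (x, 0)) (0, 1)"
    using assms(3) by (auto simp: image_subset_iff)
  have "(f has_derivative (*) (deriv f 0)) (at 0)"
    using smooth_on_real_derivative[OF assms(4,3)]
    by (simp add: has_field_derivative_def)
  then have "(?g has_derivative (\<lambda>w. deriv f 0 * snd w)) (at (0, 0))"
    using diff_chain_at[of snd snd "(0, 0)" f] bounded_linear_imp_has_derivative[OF bounded_linear_snd]
    by (fastforce simp: o_def)
  from frechet_derivative_eqI[OF this] have "g1 (0, 0) = deriv f 0" using g1(3) by simp
  moreover have "smooth_on I (\<lambda>u. g1 (0, u))"
    using assms(1)
    by (intro smooth_on_compose[OF _ g1(1)] smooth_on_Pair smooth_on_const smooth_on_ident) auto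
  ultimately show ?thesis using that[of "\<lambda>u. g1 (0, u)"] g1(2) by blast
qed


section \<open>Diffeomorphisms between plane domains\<close>

definition cross2 :: "real \<times> real \<Rightarrow> real \<times> real \<Rightarrow> real" where
  "cross2 v w = fst v * snd w - snd v * fst w"

definition jacobian :: "(real \<times> real \<Rightarrow> real \<times> real) \<Rightarrow> real \<times> real \<Rightarrow> real" where
  "jacobian F q = cross2 (frechet_derivative F (at q) (1, 0)) (frechet_derivative F (at q) (0, 1))"

lemma linear_plane_expand:
  assumes "linear (M :: real \<times> real \<Rightarrow> 'b::real_vector)"
  shows "M v = fst v *\<^sub>R M (1, 0) + snd v *\<^sub>R M (0, 1)"
proof -
  have "v = fst v *\<^sub>R (1, 0) + snd v *\<^sub>R (0, 1)" by (simp add: prod_eq_iff)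
  then have "M v = M (fst v *\<^sub>R (1, 0) + snd v *\<^sub>R (0, 1))" by simp
  then show ?thesis by (simp only: linear_add[OF assms] linear_cmul[OF assms])
qed

lemma cross2_linear_image:
  assumes "linear (M :: real \<times> real \<Rightarrow> real \<times> real)"
  shows "cross2 (M v) (M w) = cross2 (M (1, 0)) (M (0, 1)) * cross2 v w"
  unfolding linear_plane_expand[OF assms, of v] linear_plane_expand[OF assms, of w] cross2_def
  by (simp add: algebra_simps)

lemma cross2_expand: "cross2 v w *\<^sub>R u + cross2 u v *\<^sub>R w = cross2 u w *\<^sub>R v"
  unfolding cross2_def prod_eq_iff by (simp add: algebra_simps)

lemma cross2_eq_0_iff: "cross2 v w = 0 \<longleftrightarrow> (\<exists>a b. (a, b) \<noteq> (0, 0) \<and> a *\<^sub>R v + b *\<^sub>R w = 0)"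
proof
  assume 0: "cross2 v w = 0"
  show "\<exists>a b. (a, b) \<noteq> (0, 0) \<and> a *\<^sub>R v + b *\<^sub>R w = 0"
  proof (cases "v = 0")
    case True
    then have "1 *\<^sub>R v + 0 *\<^sub>R w = 0" by simp
    then show ?thesis by (metis prod.inject zero_neq_one)
  next
    case False
    show ?thesis
    proof (cases "fst v = 0")
      case True
      then have "(- snd w) *\<^sub>R v + snd v *\<^sub>R w = 0" "snd v \<noteq> 0"
        using 0 False by (auto simp: prod_eq_iff cross2_def)
      then show ?thesis by blast
    next
      case False
      then have "(- fst w) *\<^sub>R v + fst v *\<^sub>R w = 0"
        using 0 by (auto simp: prod_eq_iff cross2_def algebra_simps)
      then show ?thesis using False by blast
    qed
  qed
next
  assume "\<exists>a b. (a, b) \<noteq> (0, 0) \<and> a *\<^sub>R v + b *\<^sub>R w = 0"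
  then obtain a b where ab: "(a, b) \<noteq> (0, 0)"
    "a * fst v + b * fst w = 0" "a * snd v + b * snd w = 0"
    by (auto simp: prod_eq_iff)
  have "a * cross2 v w = (a * fst v + b * fst w) * snd w - (a * snd v + b * snd w) * fst w"
    "b * cross2 v w = (a * snd v + b * snd w) * fst v - (a * fst v + b * fst w) * snd v"
    unfolding cross2_def by algebra+
  with ab show "cross2 v w = 0" by auto
qed

lemma inj_plane_iff_cross2:
  assumes "linear (M :: real \<times> real \<Rightarrow> real \<times> real)"
  shows "inj M \<longleftrightarrow> cross2 (M (1, 0)) (M (0, 1)) \<noteq> 0"
proof -
  have "inj M \<longleftrightarrow> (\<forall>v. M v = 0 \<longrightarrow> v = 0)"
    using linear_injective_0[OF assms] .
  also have "\<dots> \<longleftrightarrow> (\<forall>a b. a *\<^sub>R M (1, 0) + b *\<^sub>R M (0, 1) = 0 \<longrightarrow> (a, b) = (0, 0))"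
    by (subst linear_plane_expand[OF assms]) (simp add: zero_prod_def)
  finally show ?thesis unfolding cross2_eq_0_iff by blast
qed

lemma cramer_plane:
  assumes "linear (M :: real \<times> real \<Rightarrow> real \<times> real)" "bij M"
  shows "inv M v = (cross2 v (M (0, 1)) * inverse (cross2 (M (1, 0)) (M (0, 1))),
                    cross2 (M (1, 0)) v * inverse (cross2 (M (1, 0)) (M (0, 1))))"
proof -
  let ?J = "cross2 (M (1, 0)) (M (0, 1))"
  have J: "?J \<noteq> 0" using assms by (simp add: inj_plane_iff_cross2[symmetric] bij_is_inj)
  have v: "M (inv M v) = v" using assms(2) by (simp add: bij_is_surj surj_f_inv_f)
  have "cross2 v (M (0, 1)) = ?J * fst (inv M v)"
    using cross2_linear_image[OF assms(1), of "inv M v" "(0, 1)"] by (simp add: v) (simp add: cross2_def)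
  moreover have "cross2 (M (1, 0)) v = ?J * snd (inv M v)"
    using cross2_linear_image[OF assms(1), of "(1, 0)" "inv M v"] by (simp add: v) (simp add: cross2_def)
  ultimately show ?thesis using J by (simp add: prod_eq_iff)
qed

text \<open>The inverse is a parameter, so that inverting and composing diffeomorphisms only
  permutes and composes explicit functions.\<close>

definition smooth_diffeo ::
  "'a::real_normed_vector set \<Rightarrow> 'b::real_normed_vector set \<Rightarrow> ('a \<Rightarrow> 'b) \<Rightarrow> ('b \<Rightarrow> 'a) \<Rightarrow> bool" where
  "smooth_diffeo S T F G \<longleftrightarrow> open S \<and> open T \<and> smooth_on S F \<and> smooth_on T G \<and>
     (\<forall>x\<in>S. F x \<in> T \<and> G (F x) = x) \<and> (\<forall>y\<in>T. G y \<in> S \<and> F (G y) = y)"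

lemma smooth_diffeo_sym: "smooth_diffeo S T F G \<Longrightarrow> smooth_diffeo T S G F"
  unfolding smooth_diffeo_def by blast

lemma smooth_diffeo_restrict:
  assumes "smooth_diffeo S T F G" "open S'" "S' \<subseteq> S"
  shows "smooth_diffeo S' (T \<inter> G -` S') F G"
proof -
  have "open (T \<inter> G -` S')"
    using assms smooth_on_imp_continuous_on unfolding smooth_diffeo_def
    by (metis continuous_on_open_vimage inf_commute)
  then show ?thesis
    using assms smooth_on_subset[of T G "T \<inter> G -` S'"] smooth_on_subset[of S F S']
    unfolding smooth_diffeo_def by auto
qed

lemma smooth_diffeo_compose:
  fixes F :: "'a::euclidean_space \<Rightarrow> 'b::euclidean_space"
    and F' :: "'b \<Rightarrow> 'c::euclidean_space"
  assumes "smooth_diffeo S T F G" "smooth_diffeo T R F' G'"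
  shows "smooth_diffeo S R (\<lambda>x. F' (F x)) (\<lambda>z. G (G' z))"
  using assms smooth_on_compose[of S T F' F] smooth_on_compose[of R T G G']
  unfolding smooth_diffeo_def by auto

text \<open>By Cramer's rule the derivative of the inverse is a rational expression in the first
  partial derivatives of the map, evaluated along the inverse; so each degree of
  differentiability of the inverse produces the next one.\<close>

lemma smooth_on_inverse_plane:
  fixes F G :: "real \<times> real \<Rightarrow> real \<times> real"
  assumes "open T" "smooth_on S F" "G ` T \<subseteq> S"
    and DG: "\<And>y. y \<in> T \<Longrightarrow> (G has_derivative inv (frechet_derivative F (at (G y)))) (at y)"
    and bij: "\<And>y. y \<in> T \<Longrightarrow> bij (frechet_derivative F (at (G y)))"
  shows "smooth_on T G"
proof -
  let ?M = "\<lambda>y. frechet_derivative F (at (G y))"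
  have lin: "linear (?M y)" if "y \<in> T" for y
    using smooth_on_derivative[OF assms(2), of "G y"] assms(3) that
    by (auto intro: has_derivative_linear)
  have "Ck_on T G n" for n
  proof (induction n)
    case 0
    show ?case
      using DG by (auto intro!: continuous_at_imp_continuous_on intro: has_derivative_continuous)
  next
    case (Suc n)
    have M: "Ck_on T (\<lambda>y. ?M y e) n" for e
      using Ck_on_compose[OF assms(1) Suc.IH _ assms(3), of "\<lambda>x. frechet_derivative F (at x) e"]
        smooth_on_frechet_derivative[OF assms(2)] by (simp add: smooth_on_def)
    have M1: "Ck_on T (\<lambda>y. fst (?M y e)) n" and M2: "Ck_on T (\<lambda>y. snd (?M y e)) n" for e
      by (rule Ck_on_linear_compose[OF assms(1) bounded_linear_fst M]
               Ck_on_linear_compose[OF assms(1) bounded_linear_snd M])+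
    have minus: "Ck_on T (\<lambda>y. k y - l y) n" if "Ck_on T k n" "Ck_on T l n" for k l :: "_ \<Rightarrow> real"
      using Ck_on_add[OF assms(1) that(1) Ck_on_mult[OF assms(1) Ck_on_const[of T "- 1"] that(2)]]
      by simp
    have cramer: "Ck_on T (\<lambda>y. (cross2 v (?M y (0, 1)) * inverse (cross2 (?M y (1, 0)) (?M y (0, 1))),
        cross2 (?M y (1, 0)) v * inverse (cross2 (?M y (1, 0)) (?M y (0, 1))))) n" for v
    proof (intro Ck_on_Pair[OF assms(1)] Ck_on_mult[OF assms(1)] Ck_on_inverse[OF assms(1)])
      show "cross2 (?M y (1, 0)) (?M y (0, 1)) \<noteq> 0" if "y \<in> T" for y
        using inj_plane_iff_cross2[OF lin[OF that]] bij_is_inj[OF bij[OF that]] by simp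
      then show "cross2 (?M y (1, 0)) (?M y (0, 1)) \<noteq> 0" if "y \<in> T" for y
        using that .
    qed (unfold cross2_def, (intro minus Ck_on_mult[OF assms(1)] M1 M2 Ck_on_const)+)
    have "Ck_on T (\<lambda>y. inv (?M y) v) n" for v
      by (rule Ck_on_cong[OF assms(1) _ cramer[of v]]) (simp add: cramer_plane[OF lin bij])
    then show ?case
      by (intro Ck_on_SucI[OF assms(1) DG])
  qed
  then show ?thesis by (simp add: smooth_on_def)
qed

lemma smooth_inverse_function_plane:
  fixes F :: "real \<times> real \<Rightarrow> real \<times> real"
  assumes "open U" "smooth_on U F" "x0 \<in> U" "inj (frechet_derivative F (at x0))"
  obtains S T G where "smooth_diffeo S T F G" "S \<subseteq> U" "x0 \<in> S"
proof -
  define F' where "F' x = Blinfun (frechet_derivative F (at x))" for x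
  have F': "blinfun_apply (F' x) = frechet_derivative F (at x)" if "x \<in> U" for x
    unfolding F'_def using smooth_on_derivative[OF assms(2) that]
    by (simp add: bounded_linear_Blinfun_apply has_derivative_bounded_linear)
  have "linear (frechet_derivative F (at x0))"
    using smooth_on_derivative[OF assms(2,3)] has_derivative_linear by blast
  then obtain L where L: "linear L" "L \<circ> frechet_derivative F (at x0) = id"
    using linear_injective_left_inverse assms(4) by blast
  have "L (frechet_derivative F (at x0) i) = i" for i
    using L(2) by (metis comp_apply id_apply)
  then have "Blinfun L o\<^sub>L F' x0 = id_blinfun"
    using L(1) F'[OF assms(3)]
    by (intro blinfun_eqI) (simp add: bounded_linear_Blinfun_apply linear_conv_bounded_linear)
  moreover have "continuous_on U F'"
  proof (rule continuous_on_blinfun_componentwise)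
    fix i :: "real \<times> real"
    show "continuous_on U (\<lambda>x. blinfun_apply (F' x) i)"
      using smooth_on_imp_continuous_on[OF smooth_on_frechet_derivative[OF assms(2), of i]]
      by (rule continuous_on_eq) (simp add: F')
  qed
  moreover have "(F has_derivative blinfun_apply (F' x)) (at x)" if "x \<in> U" for x
    using smooth_on_derivative[OF assms(2) that] F'[OF that] by simp
  ultimately obtain S T G g' where G: "open S" "S \<subseteq> U" "x0 \<in> S" "open T" "homeomorphism S T F G"
    "\<And>y. y \<in> T \<Longrightarrow> (G has_derivative g' y) (at y)"
    "\<And>y. y \<in> T \<Longrightarrow> g' y = inv (blinfun_apply (F' (G y)))"
    "\<And>y. y \<in> T \<Longrightarrow> bij (blinfun_apply (F' (G y)))"
    using inverse_function_theorem[OF assms(1) _ _ assms(3), of F F' "Blinfun L"] by metis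
  have ST: "G ` T \<subseteq> S" "\<And>x. x \<in> S \<Longrightarrow> F x \<in> T \<and> G (F x) = x"
    "\<And>y. y \<in> T \<Longrightarrow> G y \<in> S \<and> F (G y) = y"
    using G(5) by (auto simp: homeomorphism_def)
  have GU: "G y \<in> U" if "y \<in> T" for y using ST(3)[OF that] G(2) by blast
  have "smooth_on T G"
    by (rule smooth_on_inverse_plane[OF G(4) smooth_on_subset[OF assms(2) G(2)] ST(1)])
       (use G(6-8) F'[OF GU] in auto)
  then have "smooth_diffeo S T F G"
    using G(1,4) ST smooth_on_subset[OF assms(2) G(2)] by (auto simp: smooth_diffeo_def)
  then show ?thesis using that G(2,3) by blast
qed


section \<open>Linear Lorentz isometries\<close>

lemma lorentz_commute: "lorentz x y = lorentz y x"
  by (simp add: lorentz_def)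

lemma lorentz_add: "lorentz (x + y) z = lorentz x z + lorentz y z"
  "lorentz z (x + y) = lorentz z x + lorentz z y"
  by (simp_all add: lorentz_def algebra_simps)

lemma lorentz_diff: "lorentz (x - y) z = lorentz x z - lorentz y z"
  "lorentz z (x - y) = lorentz z x - lorentz z y"
  by (simp_all add: lorentz_def algebra_simps)

lemma lorentz_scaleR: "lorentz (c *\<^sub>R x) y = c * lorentz x y" "lorentz x (c *\<^sub>R y) = c * lorentz x y"
  by (simp_all add: lorentz_def algebra_simps)

lemma lorentz_nondegenerate:
  assumes "\<And>y. lorentz x y = 0" shows "x = 0"
  using assms[of "axis 1 1"] assms[of "axis 2 1"] assms[of "axis 3 1"]
  by (simp add: lorentz_def axis_def vec_eq_iff forall_3)

lemma null_vector_third_component: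
  assumes "lorentz w w = 0" "w \<noteq> 0"
  shows "w$3 \<noteq> 0"
proof
  assume "w$3 = 0"
  with assms show False by (auto simp: lorentz_def vec_eq_iff forall_3 sum_squares_eq_zero_iff)
qed

lemma linear_lorentz_isometry:
  assumes L: "linear L" "linear L'" "\<And>x. L' (L x) = x" "\<And>x. L (L' x) = x"
    and pres: "\<And>x y. lorentz (L x) (L y) = lorentz x y"
  shows "lorentz_isometry L"
proof -
  have bl: "bounded_linear L" "bounded_linear L'"
    using L(1,2) by (simp_all add: linear_conv_bounded_linear)
  have "bij L" "inv L = L'"
    using L(3,4) by (metis bijI' , metis inv_unique_comp comp_def eq_id_iff)
  moreover have "frechet_derivative L (at x) = L" for x
    using frechet_derivative_eqI[OF bounded_linear_imp_has_derivative[OF bl(1)]] .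
  ultimately show ?thesis
    unfolding lorentz_isometry_def
    using smooth_on_bounded_linear[OF open_UNIV bl(1)] smooth_on_bounded_linear[OF open_UNIV bl(2)]
      pres by simp
qed

text \<open>Besides \<open>w\<close>, the Lorentzian plane orthogonal to \<open>e\<close> contains a second null line, spanned by a
  vector \<open>w2\<close> with \<open>lorentz w2 w = 2\<close>.  The combinations \<open>f2\<close> and \<open>f3\<close> of \<open>w / s\<close> and
  \<open>s w2\<close> complete \<open>e\<close> to an orthonormal frame in which \<open>w\<close> has coordinates \<open>(0, s, s)\<close>, and
  \<open>L\<close> reads off coordinates in that frame.  The parameter \<open>s\<close> is the freedom of a boost along
  the null line of \<open>w\<close>.\<close>

lemma lorentz_frame_exists:
  assumes e: "lorentz e e = 1" "lorentz e w = 0" and w: "lorentz w w = 0" "w \<noteq> 0" and "s \<noteq> 0"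
  obtains L where "linear L" "lorentz_isometry L" "\<And>x y. lorentz (L x) (L y) = lorentz x y"
    "L e = vector [1, 0, 0]" "L w = vector [0, s, s]"
proof -
  note w3 = null_vector_third_component[OF w]
  define w1 :: "real^3" where "w1 = inverse ((w$3)\<^sup>2) *\<^sub>R vector [w$1, w$2, - w$3]"
  define k where "k = lorentz w1 e"
  define w2 where "w2 = w1 - k *\<^sub>R e + (k\<^sup>2 / 4) *\<^sub>R w"
  have sq: "(w$1)\<^sup>2 + (w$2)\<^sup>2 = (w$3)\<^sup>2"
    using w(1) by (simp add: lorentz_def power2_eq_square)
  have w1: "lorentz w1 w = 2" "lorentz w1 w1 = 0"
    using sq w3 by (simp_all add: w1_def lorentz_scaleR) (simp_all add: lorentz_def vector_3 power2_eq_square field_simps)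
  have ew: "lorentz w e = 0" using e(2) by (simp add: lorentz_commute)
  have w1': "lorentz e w1 = k" "lorentz w w1 = 2"
    using w1 by (simp_all add: k_def lorentz_commute)
  have w2: "lorentz w2 e = 0" "lorentz w2 w = 2" "lorentz w2 w2 = 0"
    unfolding w2_def
    by (simp_all add: lorentz_add lorentz_diff lorentz_scaleR e w w1 w1' ew k_def[symmetric]
        power2_eq_square)
  have w2': "lorentz e w2 = 0" "lorentz w w2 = 2"
    using w2 by (simp_all add: lorentz_commute)
  define f2 where "f2 = (1 / (2 * s)) *\<^sub>R w + (s / 2) *\<^sub>R w2"
  define f3 where "f3 = (1 / (2 * s)) *\<^sub>R w - (s / 2) *\<^sub>R w2"
  have f: "lorentz e f2 = 0" "lorentz e f3 = 0" "lorentz f2 e = 0" "lorentz f3 e = 0"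
    "lorentz f2 f2 = 1" "lorentz f3 f3 = - 1" "lorentz f2 f3 = 0" "lorentz f3 f2 = 0"
    using \<open>s \<noteq> 0\<close> unfolding f2_def f3_def
    by (simp_all add: lorentz_add lorentz_diff lorentz_scaleR e w w2 w2' ew)
  define T :: "real^3 \<Rightarrow> real^3" where "T x = x$1 *\<^sub>R e + x$2 *\<^sub>R f2 + x$3 *\<^sub>R f3" for x
  have "linear T"
    by (rule linearI) (simp_all add: T_def algebra_simps)
  have T: "lorentz (T x) (T y) = lorentz x y" for x y
    unfolding T_def by (simp add: lorentz_add lorentz_scaleR e f) (simp add: lorentz_def)
  have "inj T"
    unfolding linear_injective_0[OF \<open>linear T\<close>]
  proof (intro allI impI)
    fix x assume "T x = 0"
    then have "lorentz x y = 0" for y using T[of x y] by (simp add: lorentz_def)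
    then show "x = 0" by (rule lorentz_nondegenerate)
  qed
  then obtain L where L: "linear L" "\<And>x. L (T x) = x" "\<And>x. T (L x) = x"
    using linear_injective_isomorphism[OF \<open>linear T\<close>] by blast
  have pres: "lorentz (L x) (L y) = lorentz x y" for x y
    using T[of "L x" "L y"] L(3) by simp
  moreover have "lorentz_isometry L"
    using linear_lorentz_isometry[OF L(1) \<open>linear T\<close> L(3,2) pres] .
  moreover have "T (vector [1, 0, 0]) = e" "T (vector [0, s, s]) = w"
    using \<open>s \<noteq> 0\<close> by (simp_all add: T_def f2_def f3_def vec_eq_iff field_simps)
  ultimately show ?thesis using that L(1,2) by metis
qed


section \<open>The discriminant of the first fundamental form\<close>

lemma ds2_commute: "ds2 r q v w = ds2 r q w v"
  by (simp add: ds2_def lorentz_commute)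

lemma ds2_expand:
  assumes "r differentiable (at q)"
  shows "ds2 r q v w = coeff_E r q * (fst v * fst w)
    + coeff_F r q * (fst v * snd w + snd v * fst w) + coeff_G r q * (snd v * snd w)"
proof -
  have lin: "linear (frechet_derivative r (at q))"
    using assms by (simp add: frechet_derivative_works has_derivative_linear)
  show ?thesis
    unfolding coeff_E_def coeff_F_def coeff_G_def ds2_def
      linear_plane_expand[OF lin, of v] linear_plane_expand[OF lin, of w]
    by (simp add: lorentz_add lorentz_scaleR lorentz_commute algebra_simps)
qed

lemma gram_determinant_transform:
  fixes a b c :: real and v w :: "real \<times> real"
  defines "B \<equiv> \<lambda>v w. a * (fst v * fst w) + b * (fst v * snd w + snd v * fst w) + c * (snd v * snd w)"
  shows "B v v * B w w - (B v w)\<^sup>2 = (a * c - b\<^sup>2) * (cross2 v w)\<^sup>2"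
  unfolding B_def cross2_def by algebra

lemma discriminant_pullback:
  assumes "\<And>v w. ds2 r q v w = a * (fst (M v) * fst (M w))
      + b * (fst (M v) * snd (M w) + snd (M v) * fst (M w)) + c * (snd (M v) * snd (M w))"
  shows "discriminant r q = (a * c - b\<^sup>2) * (cross2 (M (1, 0)) (M (0, 1)))\<^sup>2"
  unfolding discriminant_def coeff_E_def coeff_F_def coeff_G_def assms
  by (rule gram_determinant_transform)

lemma null_space_iff:
  assumes "r differentiable (at q)"
  shows "v \<in> null_space r q \<longleftrightarrow>
    fst v *\<^sub>R (coeff_E r q, coeff_F r q) + snd v *\<^sub>R (coeff_F r q, coeff_G r q) = 0"
proof
  assume "v \<in> null_space r q"
  then have "ds2 r q v (1, 0) = 0" "ds2 r q v (0, 1) = 0"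
    by (simp_all add: null_space_def)
  then show "fst v *\<^sub>R (coeff_E r q, coeff_F r q) + snd v *\<^sub>R (coeff_F r q, coeff_G r q) = 0"
    by (simp add: ds2_expand[OF assms] prod_eq_iff mult.commute)
next
  assume "fst v *\<^sub>R (coeff_E r q, coeff_F r q) + snd v *\<^sub>R (coeff_F r q, coeff_G r q) = 0"
  then have 0: "fst v * coeff_E r q + snd v * coeff_F r q = 0"
    "fst v * coeff_F r q + snd v * coeff_G r q = 0" by (simp_all add: prod_eq_iff)
  have "ds2 r q v w = fst w * (fst v * coeff_E r q + snd v * coeff_F r q)
      + snd w * (fst v * coeff_F r q + snd v * coeff_G r q)" for w
    unfolding ds2_expand[OF assms] by algebra
  then show "v \<in> null_space r q" unfolding 0 by (simp add: null_space_def)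
qed

lemma degenerate_at_iff_discriminant:
  assumes "r differentiable (at q)"
  shows "degenerate_at r q \<longleftrightarrow> discriminant r q = 0"
proof -
  let ?x = "(coeff_E r q, coeff_F r q)" and ?y = "(coeff_F r q, coeff_G r q)"
  have "degenerate_at r q \<longleftrightarrow> (\<exists>a b. (a, b) \<noteq> (0, 0) \<and> a *\<^sub>R ?x + b *\<^sub>R ?y = 0)"
    unfolding degenerate_at_def null_space_iff[OF assms]
    by (simp only: split_paired_Ex fst_conv snd_conv zero_prod_def)
  also have "\<dots> \<longleftrightarrow> cross2 ?x ?y = 0" by (rule cross2_eq_0_iff[symmetric])
  finally show ?thesis by (simp add: discriminant_def cross2_def power2_eq_square)
qed

lemma discriminant_reparametrize:
  assumes "(\<tau> has_derivative M) (at q)" "r differentiable (at (\<tau> q))"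
    "open N" "q \<in> N" "\<And>x. x \<in> N \<Longrightarrow> r' x = r (\<tau> x)"
  shows "discriminant r' q = discriminant r (\<tau> q) * (cross2 (M (1, 0)) (M (0, 1)))\<^sup>2"
proof -
  have "((\<lambda>x. r (\<tau> x)) has_derivative (\<lambda>v. frechet_derivative r (at (\<tau> q)) (M v))) (at q)"
    using diff_chain_at[OF assms(1)] assms(2) by (fastforce simp: frechet_derivative_works o_def)
  then have "(r' has_derivative (\<lambda>v. frechet_derivative r (at (\<tau> q)) (M v))) (at q)"
    by (rule has_derivative_transform_within_open[OF _ assms(3,4)]) (simp add: assms(5))
  from frechet_derivative_eqI[OF this]
  have "ds2 r' q v w = ds2 r (\<tau> q) (M v) (M w)" for v w
    by (simp add: ds2_def)
  from discriminant_pullback[of r' q, OF this[unfolded ds2_expand[OF assms(2)]]]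
  show ?thesis by (simp add: discriminant_def)
qed

lemma smooth_on_discriminant:
  assumes "open S" "smooth_on S r" shows "smooth_on S (discriminant r)"
proof -
  note D = smooth_on_linear_compose[OF assms(1) bounded_linear_vec_nth
      smooth_on_frechet_derivative[OF assms(2)]]
  show ?thesis
    unfolding discriminant_def[abs_def] coeff_E_def coeff_F_def coeff_G_def ds2_def lorentz_def
    by (intro smooth_on_diff[OF assms(1)] smooth_on_mult[OF assms(1)] smooth_on_power[OF assms(1)]
        smooth_on_add[OF assms(1)] D)
qed

text \<open>A vector orthogonal to a non-zero null vector \<open>w\<close> cannot be timelike: by the
  Cauchy--Schwarz identity in the spatial plane its square is a square divided by \<open>w\<^sub>3\<^sup>2\<close>.\<close>

lemma orthogonal_to_null_nonneg:
  assumes "lorentz w w = 0" "w \<noteq> 0" "lorentz e w = 0"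
  shows "lorentz e e \<ge> 0"
proof -
  note w3 = null_vector_third_component[OF assms(1,2)]
  have "(w$1)\<^sup>2 + (w$2)\<^sup>2 = (w$3)\<^sup>2" "e$3 * w$3 = e$1 * w$1 + e$2 * w$2"
    using assms(1,3) by (simp_all add: lorentz_def power2_eq_square)
  then have "lorentz e e * (w$3)\<^sup>2 = (e$1 * w$2 - e$2 * w$1)\<^sup>2"
    unfolding lorentz_def by algebra
  then show ?thesis
    using w3 by (metis zero_le_power2 zero_less_power2 zero_le_mult_iff not_le)
qed

text \<open>The form \<open>ds2\<close> vanishes as soon as one argument is \<open>n\<close>.  A vector \<open>e\<close> outside the null space is
  independent of \<open>n\<close>, so \<open>ds2 e e = 0\<close> would make \<open>e\<close> orthogonal to a basis and put it into the
  null space after all.\<close>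

lemma tangent_frame_at_lightlike_point:
  assumes r: "r differentiable (at q)" "inj (frechet_derivative r (at q))"
    and n: "n \<in> null_space r q" "n \<noteq> 0" and e: "e \<notin> null_space r q"
  shows "lorentz (frechet_derivative r (at q) n) (frechet_derivative r (at q) n) = 0"
    "frechet_derivative r (at q) n \<noteq> 0"
    "lorentz (frechet_derivative r (at q) e) (frechet_derivative r (at q) n) = 0"
    "lorentz (frechet_derivative r (at q) e) (frechet_derivative r (at q) e) > 0"
    "cross2 e n \<noteq> 0"
proof -
  let ?D = "frechet_derivative r (at q)"
  have lin: "linear ?D" using r(1) by (simp add: frechet_derivative_works has_derivative_linear)
  have nw1: "ds2 r q n v = 0" for v
    using n(1) unfolding null_space_def by blast
  have nw: "ds2 r q n v = 0" "ds2 r q v n = 0" for v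
    using nw1[of v] ds2_commute[of r q v n] by simp_all
  then show 1: "lorentz (?D n) (?D n) = 0" "lorentz (?D e) (?D n) = 0"
    by (simp_all add: ds2_def)
  show 2: "?D n \<noteq> 0"
    using r(2) n(2) linear_injective_0[OF lin] by blast
  show cross: "cross2 e n \<noteq> 0"
  proof
    assume "cross2 e n = 0"
    then obtain a b where ab: "(a, b) \<noteq> (0, 0)" "a *\<^sub>R e + b *\<^sub>R n = 0"
      unfolding cross2_eq_0_iff by blast
    then have "a \<noteq> 0" using n(2) by auto
    have "ds2 r q (a *\<^sub>R e + b *\<^sub>R n) v = a * ds2 r q e v" for v
      using nw(1)[of v] by (simp add: ds2_def linear_add[OF lin] linear_cmul[OF lin] lorentz_add lorentz_scaleR)
    then have "ds2 r q e v = 0" for v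
      using ab(2) \<open>a \<noteq> 0\<close> by (simp add: ds2_def linear_0[OF lin] lorentz_def)
    then show False using e by (simp add: null_space_def)
  qed
  have "ds2 r q e e \<noteq> 0"
  proof
    assume 0: "ds2 r q e e = 0"
    have "ds2 r q e v = 0" for v
    proof -
      have "cross2 e n * ds2 r q e v = cross2 v n * ds2 r q e e + cross2 e v * ds2 r q e n"
        unfolding ds2_def by (metis cross2_expand linear_add[OF lin] linear_cmul[OF lin] lorentz_add(2) lorentz_scaleR(2))
      then show ?thesis using 0 nw cross by simp
    qed
    then show False using e by (simp add: null_space_def)
  qed
  moreover have "ds2 r q e e \<ge> 0"
    using orthogonal_to_null_nonneg[OF 1(1) 2 1(2)] by (simp add: ds2_def)
  ultimately show "lorentz (?D e) (?D e) > 0" by (simp add: ds2_def)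
qed


section \<open>Coordinates adapted to the lightlike curve of a graph\<close>

definition partial_x :: "(real \<times> real \<Rightarrow> real) \<Rightarrow> real \<times> real \<Rightarrow> real" where
  "partial_x h p = frechet_derivative h (at p) (1, 0)"

definition partial_y :: "(real \<times> real \<Rightarrow> real) \<Rightarrow> real \<times> real \<Rightarrow> real" where
  "partial_y h p = frechet_derivative h (at p) (0, 1)"

lemma smooth_on_partials:
  assumes "smooth_on S h" shows "smooth_on S (partial_x h)" "smooth_on S (partial_y h)"
  unfolding partial_x_def[abs_def] partial_y_def[abs_def]
  using smooth_on_frechet_derivative[OF assms] by auto

lemma has_derivative_partials:
  assumes "smooth_on S h" "p \<in> S"
  shows "(h has_derivative (\<lambda>w. fst w * partial_x h p + snd w * partial_y h p)) (at p)"
proof -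
  note D = smooth_on_derivative[OF assms]
  have "frechet_derivative h (at p) = (\<lambda>w. fst w * partial_x h p + snd w * partial_y h p)"
    using linear_plane_expand[OF has_derivative_linear[OF D]]
    unfolding partial_x_def partial_y_def real_scaleR_def by (rule ext)
  with D show ?thesis by simp
qed

lemma has_real_derivative_along_graph:
  assumes "smooth_on S k" "(u, \<beta> u) \<in> S" "(\<beta> has_real_derivative b) (at u)"
  shows "((\<lambda>u. k (u, \<beta> u)) has_real_derivative
           (partial_x k (u, \<beta> u) + b * partial_y k (u, \<beta> u))) (at u)"
proof -
  have "((\<lambda>u. (u, \<beta> u)) has_derivative (\<lambda>h. (h, b * h))) (at u)"
    using assms(3) unfolding has_field_derivative_def
    by (intro has_derivative_Pair has_derivative_ident)
  from diff_chain_at[OF this has_derivative_partials[OF assms(1,2)]]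
  show ?thesis
    unfolding has_field_derivative_def o_def
    by (rule has_derivative_eq_rhs) (auto simp: algebra_simps)
qed

lemma smooth_on_deriv:
  fixes f :: "real \<Rightarrow> real"
  assumes "open I" "smooth_on I f"
  shows "smooth_on I (deriv f)"
proof (rule smooth_on_open_cong[OF assms(1) smooth_on_frechet_derivative[OF assms(2), of 1]])
  fix x assume "x \<in> I"
  from smooth_on_real_derivative[OF assms(2) this]
  show "frechet_derivative f (at x) 1 = deriv f x"
    unfolding has_field_derivative_def by (simp add: frechet_derivative_eqI)
qed

text \<open>The lightlike points of a graph \<open>z = h (x, y)\<close> are the solutions of
  \<open>h\<^sub>x\<^sup>2 + h\<^sub>y\<^sup>2 = 1\<close>; since the \<open>y\<close>-derivative of the left-hand side is \<open>2 h\<^sub>y h\<^sub>y\<^sub>y = 1\<close>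
  at the origin, they form a curve \<open>y = \<beta> x\<close>, which touches the \<open>x\<close>-axis because \<open>h\<^sub>x\<^sub>y\<close>
  vanishes there.\<close>

lemma lightlike_curve_of_graph:
  assumes "open \<Omega>" "smooth_on \<Omega> h" "(0, 0) \<in> \<Omega>"
    and h: "partial_x h (0, 0) = 0" "partial_y h (0, 0) = 1"
      "partial_x (partial_y h) (0, 0) = 0" "partial_y (partial_y h) (0, 0) = 1 / 2"
  obtains I \<beta> where "open I" "is_interval I" "0 \<in> I" "smooth_on I \<beta>" "\<beta> 0 = 0" "deriv \<beta> 0 = 0"
    "\<And>u. u \<in> I \<Longrightarrow> (u, \<beta> u) \<in> \<Omega>"
    "\<And>u. u \<in> I \<Longrightarrow> (partial_x h (u, \<beta> u))\<^sup>2 + (partial_y h (u, \<beta> u))\<^sup>2 = 1"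
    "\<And>u. u \<in> I \<Longrightarrow> partial_y h (u, \<beta> u) > 0"
proof -
  let ?q = "\<lambda>p. (partial_x h p)\<^sup>2 + (partial_y h p)\<^sup>2 - 1"
  note sp = smooth_on_partials[OF assms(2)]
  have sq: "smooth_on \<Omega> ?q"
    by (intro smooth_on_diff smooth_on_add smooth_on_power smooth_on_const sp assms(1))
  have "(?q has_derivative (\<lambda>w. snd w)) (at (0, 0))"
  proof -
    note Dx = has_derivative_partials[OF sp(1) assms(3)]
    note Dy = has_derivative_partials[OF sp(2) assms(3)]
    show ?thesis
      using has_derivative_diff[OF has_derivative_add[OF has_derivative_power[OF Dx, of 2]
            has_derivative_power[OF Dy, of 2]] has_derivative_const[of 1]]
      by (simp add: h)
  qed
  note Dq = this
  have q0: "partial_x ?q (0, 0) = 0" "partial_y ?q (0, 0) = 1"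
    unfolding partial_x_def[of ?q] partial_y_def[of ?q] frechet_derivative_eqI[OF Dq] by simp_all
  define Q where "Q p = (fst p, ?q p)" for p
  define U where "U = \<Omega> \<inter> partial_y h -` {0<..}"
  have U: "open U" "U \<subseteq> \<Omega>" "(0, 0) \<in> U"
    using continuous_open_preimage[OF smooth_on_imp_continuous_on[OF sp(2)] assms(1), of "{0<..}"]
      assms(3) h by (auto simp: U_def)
  have "smooth_on U Q"
    unfolding Q_def[abs_def]
    by (intro smooth_on_Pair smooth_on_fst smooth_on_ident smooth_on_subset[OF sq] U)
  moreover have "(Q has_derivative (\<lambda>w. (fst w, snd w))) (at (0, 0))"
    unfolding Q_def[abs_def]
    by (intro has_derivative_Pair Dq bounded_linear_imp_has_derivative bounded_linear_fst)
  then have "inj (frechet_derivative Q (at (0, 0)))"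
    by (simp add: frechet_derivative_eqI inj_on_def)
  ultimately obtain S T G where G: "smooth_diffeo S T Q G" "S \<subseteq> U" "(0, 0) \<in> S"
    using smooth_inverse_function_plane[OF U(1) _ U(3)] by metis
  have ST: "open T" "smooth_on T G" "\<And>x. x \<in> S \<Longrightarrow> Q x \<in> T \<and> G (Q x) = x"
     "\<And>y. y \<in> T \<Longrightarrow> G y \<in> S \<and> Q (G y) = y"
    using G(1) by (auto simp: smooth_diffeo_def)
  have Q0: "Q (0, 0) = (0, 0)" using h by (simp add: Q_def)
  then have T0: "(0, 0) \<in> T" "G (0, 0) = (0, 0)" using ST(3)[OF G(3)] by auto
  have "open ((\<lambda>x::real. (x, 0::real)) -` T)"
    using ST(1) by (rule open_vimage) (intro continuous_intros)
  then obtain \<epsilon> where \<epsilon>: "\<epsilon> > 0" "ball 0 \<epsilon> \<subseteq> (\<lambda>x::real. (x, 0::real)) -` T"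
    using T0 open_contains_ball by (metis vimage_eq)
  define I where "I = ball (0::real) \<epsilon>"
  have I: "open I" "is_interval I" "0 \<in> I" "\<And>u. u \<in> I \<Longrightarrow> (u, 0) \<in> T"
    using \<epsilon> by (auto simp: I_def is_interval_ball_real)
  define \<beta> where "\<beta> u = snd (G (u, 0))" for u
  have G\<beta>: "G (u, 0) = (u, \<beta> u)" if "u \<in> I" for u
    using ST(4)[OF I(4)[OF that]] by (auto simp: \<beta>_def Q_def prod_eq_iff)
  have "smooth_on I (\<lambda>u. G (u, 0))"
    using I(1,4) by (intro smooth_on_compose[OF _ ST(2)] smooth_on_Pair smooth_on_ident smooth_on_const) auto
  then have s\<beta>: "smooth_on I \<beta>"
    unfolding \<beta>_def[abs_def] by (rule smooth_on_snd[OF I(1)])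
  have \<beta>0: "\<beta> 0 = 0" by (simp add: \<beta>_def T0)
  have curve: "(u, \<beta> u) \<in> U" "?q (u, \<beta> u) = 0" if "u \<in> I" for u
    using ST(4)[OF I(4)[OF that]] G(2) G\<beta>[OF that] by (auto simp: Q_def)
  have "((\<lambda>u. ?q (u, \<beta> u)) has_real_derivative deriv \<beta> 0) (at 0)"
    using has_real_derivative_along_graph[where u = 0 and \<beta> = \<beta>, OF sq _ smooth_on_real_derivative[OF s\<beta> I(3)]]
      assms(3) by (simp only: \<beta>0 q0) simp
  moreover have "((\<lambda>u. ?q (u, \<beta> u)) has_real_derivative 0) (at 0)"
    by (rule has_field_derivative_transform_within_open[OF DERIV_const[of 0] I(1,3)])
       (simp add: curve(2))
  ultimately have "deriv \<beta> 0 = 0" by (rule DERIV_unique)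
  moreover have "(partial_x h (u, \<beta> u))\<^sup>2 + (partial_y h (u, \<beta> u))\<^sup>2 = 1" if "u \<in> I" for u
    using curve(2)[OF that] by simp
  ultimately show ?thesis
    using that[of I \<beta>] I(1-3) s\<beta> \<beta>0 curve(1) by (auto simp: U_def)
qed

lemma integral_from_zero_on_interval:
  assumes "open I" "is_interval I" "0 \<in> I" "u \<in> I" "continuous_on I \<phi>"
    "\<And>t. t \<in> I \<Longrightarrow> (F has_real_derivative \<phi> t) (at t)"
  shows "(LBINT t=ereal 0..ereal u. \<phi> t) = F u - F 0"
proof -
  have I: "{min 0 u..max 0 u} \<subseteq> I"
  proof
    fix x assume x: "x \<in> {min 0 u..max 0 u}"
    have "min 0 u \<in> I" "max 0 u \<in> I" using assms(3,4) by (simp_all add: min_def max_def)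
    then show "x \<in> I" by (rule mem_is_interval_1_I[OF assms(2)]) (use x in auto)
  qed
  show ?thesis
  proof (rule interval_integral_FTC_finite)
    show "continuous_on {min 0 u..max 0 u} \<phi>"
      by (rule continuous_on_subset[OF assms(5) I])
    show "(F has_vector_derivative \<phi> x) (at x within {min 0 u..max 0 u})"
      if "min 0 u \<le> x" "x \<le> max 0 u" for x
    proof -
      have "x \<in> {min 0 u..max 0 u}" using that by simp
      with I have "x \<in> I" by blast
      from assms(6)[OF this] show ?thesis
        by (simp only: has_real_derivative_iff_has_vector_derivative has_vector_derivative_at_within)
    qed
  qed
qed

text \<open>Along the lightlike curve \<open>y = \<beta> x\<close> the null direction with \<open>dy = 1\<close> projects to \<open>(\<alpha>, 1)\<close> where
  \<open>\<alpha> = h\<^sub>x / h\<^sub>y\<close>.  The coordinates \<open>H (u, v) = (u + v \<alpha> u, v + \<beta> u)\<close> put the curve on the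
  \<open>u\<close>-axis and make the lines \<open>u = const\<close> leave it in the null direction.  Since
  \<open>h\<^sub>x\<^sup>2 + h\<^sub>y\<^sup>2 = 1\<close> on the curve, \<open>\<alpha>\<^sup>2 + 1 = 1 / h\<^sub>y\<^sup>2\<close>; this turns the height along the axis,
  with derivative \<open>h\<^sub>x + h\<^sub>y \<beta>' = h\<^sub>y (\<alpha> + \<beta>')\<close>, into the stated integral and the first
  \<open>v\<close>-derivative \<open>\<alpha> h\<^sub>x + h\<^sub>y = 1 / h\<^sub>y\<close> into the stated square root.  The rest of the height is
  the second-order Taylor remainder in \<open>v\<close>, which at the origin is \<open>h\<^sub>y\<^sub>y / 2\<close>.\<close>

lemma graph_normal_form:
  assumes "open \<Omega>" "smooth_on \<Omega> h" "(0, 0) \<in> \<Omega>" "h (0, 0) = 0"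
    and h: "partial_x h (0, 0) = 0" "partial_y h (0, 0) = 1"
      "partial_x (partial_y h) (0, 0) = 0" "partial_y (partial_y h) (0, 0) = 1 / 2"
  obtains E T H K I a1 a2 b2 where "smooth_diffeo E T H K" "(0, 0) \<in> E" "H (0, 0) = (0, 0)" "T \<subseteq> \<Omega>"
    "open I" "is_interval I" "\<forall>(u, v)\<in>E. u \<in> I"
    "smooth_on I a1" "smooth_on I a2" "smooth_on E b2" "b2 (0, 0) = 1 / 4"
    "\<forall>(u, v)\<in>E. H (u, v) = (u + u * v * a1 u, v + u\<^sup>2 * a2 u)"
    "\<forall>(u, v)\<in>E. h (H (u, v)) =
       (LBINT t=ereal 0..ereal u. t * (a1 t + 2 * a2 t + t * deriv a2 t) / sqrt (t\<^sup>2 * (a1 t)\<^sup>2 + 1))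
       + v * sqrt (u\<^sup>2 * (a1 u)\<^sup>2 + 1) + v\<^sup>2 * b2 (u, v)"
proof -
  note sp = smooth_on_partials[OF assms(2)]
  obtain I \<beta> where I: "open I" "is_interval I" "0 \<in> I"
    and \<beta>: "smooth_on I \<beta>" "\<beta> 0 = 0" "deriv \<beta> 0 = 0"
    and curve: "\<And>u. u \<in> I \<Longrightarrow> (u, \<beta> u) \<in> \<Omega>"
      "\<And>u. u \<in> I \<Longrightarrow> (partial_x h (u, \<beta> u))\<^sup>2 + (partial_y h (u, \<beta> u))\<^sup>2 = 1"
      "\<And>u. u \<in> I \<Longrightarrow> partial_y h (u, \<beta> u) > 0"
    using lightlike_curve_of_graph[OF assms(1-3) h] by metis

  \<comment> \<open>\<open>(\<alpha>, 1, 1 / h\<^sub>y)\<close> is the null direction along the lightlike curve.\<close>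
  define \<alpha> where "\<alpha> u = partial_x h (u, \<beta> u) / partial_y h (u, \<beta> u)" for u
  have along: "smooth_on I (\<lambda>u. k (u, \<beta> u))" if "smooth_on \<Omega> k" for k :: "real \<times> real \<Rightarrow> real"
    using curve(1) by (intro smooth_on_compose[OF I(1) that] smooth_on_Pair smooth_on_ident \<beta> I) auto
  have \<alpha>: "smooth_on I \<alpha>"
    unfolding \<alpha>_def[abs_def] using curve(3)
    by (intro smooth_on_divide along sp I(1)) (auto simp: less_imp_neq[symmetric])
  have \<alpha>0: "\<alpha> 0 = 0" by (simp add: \<alpha>_def \<beta> h)
  obtain a1 where a1: "smooth_on I a1" "\<And>u. u \<in> I \<Longrightarrow> \<alpha> u = u * a1 u"
    using hadamard_real[OF I \<alpha>] \<alpha>0 by (metis add_0)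
  obtain b where b: "smooth_on I b" "\<And>u. u \<in> I \<Longrightarrow> \<beta> u = u * b u" "b 0 = 0"
    using hadamard_real[OF I \<beta>(1)] \<beta> by (metis add_0)
  obtain a2 where a2': "smooth_on I a2" "\<And>u. u \<in> I \<Longrightarrow> b u = u * a2 u"
    using hadamard_real[OF I b(1)] b(3) by (metis add_0)
  have a2: "\<beta> u = u\<^sup>2 * a2 u" if "u \<in> I" for u
    using b(2)[OF that] a2'(2)[OF that] by (simp add: power2_eq_square)

  have norm: "sqrt (u\<^sup>2 * (a1 u)\<^sup>2 + 1) = 1 / partial_y h (u, \<beta> u)" if "u \<in> I" for u
  proof -
    have "u\<^sup>2 * (a1 u)\<^sup>2 + 1 = (\<alpha> u)\<^sup>2 + 1" using a1(2)[OF that] by (simp add: power_mult_distrib)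
    also have "\<dots> = (1 / partial_y h (u, \<beta> u))\<^sup>2"
      using curve(2,3)[OF that] by (simp add: \<alpha>_def power_divide field_simps)
    finally show ?thesis using curve(3)[OF that] by simp
  qed

  define \<phi> where "\<phi> t = t * (a1 t + 2 * a2 t + t * deriv a2 t) / sqrt (t\<^sup>2 * (a1 t)\<^sup>2 + 1)" for t
  have cont: "continuous_on I \<phi>"
  proof -
    have "sqrt (t\<^sup>2 * (a1 t)\<^sup>2 + 1) \<noteq> 0" if "t \<in> I" for t
      using norm[OF that] curve(3)[OF that] by simp
    then show ?thesis
      unfolding \<phi>_def
      using a1(1) a2'(1) smooth_on_deriv[OF I(1) a2'(1)]
      by (intro continuous_intros smooth_on_imp_continuous_on) auto
  qed
  have D\<phi>: "((\<lambda>u. h (u, \<beta> u)) has_real_derivative \<phi> t) (at t)" if t: "t \<in> I" for t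
  proof -
    have "((\<lambda>u. u\<^sup>2 * a2 u) has_real_derivative 2 * t * a2 t + t\<^sup>2 * deriv a2 t) (at t)"
      using smooth_on_real_derivative[OF a2'(1) t] by (auto intro!: derivative_eq_intros)
    then have "(\<beta> has_real_derivative 2 * t * a2 t + t\<^sup>2 * deriv a2 t) (at t)"
      by (rule has_field_derivative_transform_within_open[OF _ I(1) t]) (simp add: a2)
    note D = has_real_derivative_along_graph[where \<beta> = \<beta>, OF assms(2) curve(1)[OF t] this]
    have "partial_x h (t, \<beta> t) = t * a1 t * partial_y h (t, \<beta> t)"
      using a1(2)[OF t] curve(3)[OF t] by (simp add: \<alpha>_def field_simps)
    then have "\<phi> t = partial_x h (t, \<beta> t) + (2 * t * a2 t + t\<^sup>2 * deriv a2 t) * partial_y h (t, \<beta> t)"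
      unfolding \<phi>_def norm[OF t] using curve(3)[OF t] by (simp add: field_simps power2_eq_square)
    with D show ?thesis by simp
  qed
  have axis: "h (u, \<beta> u) = (LBINT t=ereal 0..ereal u. \<phi> t)" if "u \<in> I" for u
    using integral_from_zero_on_interval[OF I that cont D\<phi>] by (simp add: \<beta> assms(4))

  define H where "H p = (fst p + snd p * \<alpha> (fst p), snd p + \<beta> (fst p))" for p
  have H0: "H (0, 0) = (0, 0)" by (simp add: H_def \<beta>)
  have oI: "open (I \<times> UNIV :: (real \<times> real) set)" using I(1) by (simp add: open_Times)
  have sH: "smooth_on (I \<times> UNIV) H"
    unfolding H_def[abs_def] using oI
    by (intro smooth_on_Pair smooth_on_add smooth_on_mult smooth_on_fst smooth_on_snd smooth_on_ident
        smooth_on_compose[OF _ \<alpha>] smooth_on_compose[OF _ \<beta>(1)]) auto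
  have DH: "(H has_derivative (\<lambda>w. (fst w + (snd p * (deriv \<alpha> (fst p) * fst w) + snd w * \<alpha> (fst p)),
      snd w + deriv \<beta> (fst p) * fst w))) (at p)" if "fst p \<in> I" for p
  proof -
    have fst: "(fst has_derivative fst) (at p)" and snd: "(snd has_derivative snd) (at p)"
      by (rule bounded_linear_imp_has_derivative[OF bounded_linear_fst]
               bounded_linear_imp_has_derivative[OF bounded_linear_snd])+
    have comp_fst: "((\<lambda>p. f (fst p)) has_derivative (\<lambda>w. deriv f (fst p) * fst w)) (at p)"
      if "smooth_on I f" for f
      using diff_chain_at[OF fst smooth_on_real_derivative[OF that \<open>fst p \<in> I\<close>, unfolded has_field_derivative_def]]
      by (simp add: o_def)
    show ?thesis
      unfolding H_def[abs_def]
      by (intro has_derivative_Pair has_derivative_add has_derivative_mult fst snd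
          comp_fst[OF \<alpha>] comp_fst[OF \<beta>(1)])
  qed
  define U where "U = (I \<times> UNIV) \<inter> H -` \<Omega>"
  have U: "open U" "(0, 0) \<in> U" "U \<subseteq> I \<times> UNIV"
    using continuous_open_preimage[OF smooth_on_imp_continuous_on[OF sH] oI assms(1)] I(3) assms(3) H0
    by (auto simp: U_def)
  have "inj (frechet_derivative H (at (0, 0)))"
    using frechet_derivative_eqI[OF DH[of "(0, 0)"]] I(3) by (simp add: \<alpha>0 \<beta> inj_on_def)
  then obtain S T0 K where K: "smooth_diffeo S T0 H K" "S \<subseteq> U" "(0, 0) \<in> S"
    using smooth_inverse_function_plane[OF U(1) smooth_on_subset[OF sH U(3)] U(2)] by metis
  have "open S" using K(1) by (simp add: smooth_diffeo_def)
  then obtain \<delta> where \<delta>: "\<delta> > 0" "ball (0, 0) \<delta> \<subseteq> S"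
    using K(3) open_contains_ball by metis
  define E where "E = ball (0 :: real, 0 :: real) \<delta>"
  have E: "open E" "convex E" "(0, 0) \<in> E" "E \<subseteq> S" "E \<subseteq> I \<times> UNIV"
    using \<delta> K(2) U(3) by (auto simp: E_def)
  have proj: "(\<lambda>p. (fst p, 0)) ` E \<subseteq> E"
  proof clarify
    fix u v assume "(u, v) \<in> E"
    then show "(fst (u, v), 0) \<in> E"
      by (simp add: E_def dist_norm norm_Pair le_less_trans[OF real_sqrt_ge_abs1[of u v]])
  qed
  note EK = smooth_diffeo_restrict[OF K(1) E(1,4)]
  have HE: "H p \<in> \<Omega>" if "p \<in> E" for p using that E(4) K(2) by (auto simp: U_def)

  define z where "z p = h (H p)" for p
  have z: "smooth_on E z"
    unfolding z_def[abs_def]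
    using HE by (intro smooth_on_compose[OF E(1) assms(2)] smooth_on_subset[OF sH E(5)]) auto
  have zv: "frechet_derivative z (at p) (0, 1)
      = \<alpha> (fst p) * partial_x h (H p) + partial_y h (H p)" if "p \<in> E" for p
  proof -
    have "fst p \<in> I" using that E(5) by auto
    from diff_chain_at[OF DH[OF this] has_derivative_partials[OF assms(2) HE[OF that]]]
    have "(z has_derivative (\<lambda>w. fst w * partial_x h (H p) + snd w * partial_y h (H p)) \<circ>
       (\<lambda>w. (fst w + (snd p * (deriv \<alpha> (fst p) * fst w) + snd w * \<alpha> (fst p)),
          snd w + deriv \<beta> (fst p) * fst w))) (at p)"
      by (simp add: z_def[abs_def] o_def)
    from frechet_derivative_eqI[OF this] show ?thesis by simp
  qed
  obtain b2 where b2: "smooth_on E b2"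
    "\<And>u v. (u, v) \<in> E \<Longrightarrow>
       z (u, v) = z (u, 0) + v * frechet_derivative z (at (u, 0)) (0, 1) + v\<^sup>2 * b2 (u, v)"
    "\<And>u. (u, 0) \<in> E \<Longrightarrow>
       2 * b2 (u, 0) = frechet_derivative (\<lambda>p. frechet_derivative z (at p) (0, 1)) (at (u, 0)) (0, 1)"
    using taylor_second_order[OF E(1,2) z proj] by metis
  have "frechet_derivative (\<lambda>p. frechet_derivative z (at p) (0, 1)) (at (0, 0)) (0, 1) = 1 / 2"
  proof -
    have DH0: "(H has_derivative (\<lambda>w. w)) (at (0, 0))"
      using DH[of "(0, 0)"] I(3) by (simp add: \<alpha>0 \<beta>)
    have comp: "((\<lambda>p. k (H p)) has_derivative
        (\<lambda>w. fst w * partial_x k (0, 0) + snd w * partial_y k (0, 0))) (at (0, 0))"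
      if "smooth_on \<Omega> k" for k
      using diff_chain_at[OF DH0, of k] has_derivative_partials[OF that assms(3)] H0
      by (simp add: o_def)
    have D\<alpha>: "((\<lambda>p. \<alpha> (fst p)) has_derivative (\<lambda>w. deriv \<alpha> 0 * fst w)) (at (0, 0 :: real))"
      using diff_chain_at[of fst fst "(0, 0 :: real)" \<alpha>]
        bounded_linear_imp_has_derivative[OF bounded_linear_fst]
        smooth_on_real_derivative[OF \<alpha> I(3), unfolded has_field_derivative_def]
      by (fastforce simp: o_def)
    have "((\<lambda>p. frechet_derivative z (at p) (0, 1)) has_derivative
       (\<lambda>w. (\<alpha> (fst (0, 0 :: real)) * (fst w * partial_x (partial_x h) (0, 0) + snd w * partial_y (partial_x h) (0, 0))
         + (deriv \<alpha> 0 * fst w) * partial_x h (H (0, 0)))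
         + (fst w * partial_x (partial_y h) (0, 0) + snd w * partial_y (partial_y h) (0, 0)))) (at (0, 0))"
      by (rule has_derivative_transform_within_open[OF
            has_derivative_add[OF has_derivative_mult[OF D\<alpha> comp[OF sp(1)]] comp[OF sp(2)]] E(1,3)])
         (simp add: zv)
    from frechet_derivative_eqI[OF this] show ?thesis by (simp add: \<alpha>0 H0 h)
  qed
  then have b20: "b2 (0, 0) = 1 / 4" using b2(3)[OF E(3)] by simp
  have zform: "h (H (u, v)) = (LBINT t=ereal 0..ereal u. \<phi> t)
       + v * sqrt (u\<^sup>2 * (a1 u)\<^sup>2 + 1) + v\<^sup>2 * b2 (u, v)" if uv: "(u, v) \<in> E" for u v
  proof -
    have u: "u \<in> I" "(u, 0) \<in> E" using uv E(5) proj by (auto simp: image_subset_iff)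
    have H: "H (u, 0) = (u, \<beta> u)" by (simp add: H_def)
    have "frechet_derivative z (at (u, 0)) (0, 1) = sqrt (u\<^sup>2 * (a1 u)\<^sup>2 + 1)"
      unfolding zv[OF u(2)] norm[OF u(1)] H
      using curve(2,3)[OF u(1)] by (simp add: \<alpha>_def field_simps power2_eq_square)
    with b2(2)[OF uv] show ?thesis by (simp add: z_def H axis[OF u(1)])
  qed
  have Hform: "H (u, v) = (u + u * v * a1 u, v + u\<^sup>2 * a2 u)" if "(u, v) \<in> E" for u v
    using a1(2)[of u] a2[of u] that E(5) by (auto simp: H_def)
  have sub: "T0 \<inter> K -` E \<subseteq> \<Omega>"
  proof
    fix y assume "y \<in> T0 \<inter> K -` E"
    then have "K y \<in> E" "H (K y) = y" using K(1) by (auto simp: smooth_diffeo_def)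
    then show "y \<in> \<Omega>" using HE by metis
  qed
  have "\<forall>(u, v)\<in>E. u \<in> I" using E(5) by blast
  moreover have "\<forall>(u, v)\<in>E. H (u, v) = (u + u * v * a1 u, v + u\<^sup>2 * a2 u)"
    using Hform by blast
  moreover have "\<forall>(u, v)\<in>E. h (H (u, v)) =
       (LBINT t=ereal 0..ereal u. t * (a1 t + 2 * a2 t + t * deriv a2 t) / sqrt (t\<^sup>2 * (a1 t)\<^sup>2 + 1))
       + v * sqrt (u\<^sup>2 * (a1 u)\<^sup>2 + 1) + v\<^sup>2 * b2 (u, v)"
    using zform unfolding \<phi>_def by blast
  ultimately show ?thesis
    by (rule that[OF EK E(3) H0 sub I(1,2) _ a1(1) a2'(1) b2(1) b20])
qed


section \<open>Lorentz position of a surface germ\<close>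

lemma vec_eq_vector_3: "(x :: real^3) = vector [a, b, c] \<longleftrightarrow> x$1 = a \<and> x$2 = b \<and> x$3 = c"
  by (auto simp: vec_eq_iff forall_3)

text \<open>The graph of \<open>h\<close> has first fundamental form \<open>dx\<^sup>2 + dy\<^sup>2 - dh\<^sup>2\<close> with Gram determinant
  \<open>1 - h\<^sub>x\<^sup>2 - h\<^sub>y\<^sup>2\<close>.  Any other parametrization of the graph multiplies it by the squared Jacobian
  of the projection \<open>P\<close> to the \<open>xy\<close>-plane.\<close>

lemma discriminant_of_graph:
  assumes "(P has_derivative M) (at x)" "(h has_derivative (\<lambda>w. fst w * a + snd w * b)) (at (P x))"
    and L: "bounded_linear L" "\<And>v w. lorentz (L v) (L w) = lorentz v w" "r differentiable (at x)"
    and N: "open N" "x \<in> N" "\<And>y. y \<in> N \<Longrightarrow> L (r y) = vector [fst (P y), snd (P y), h (P y)]"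
  shows "discriminant r x = (1 - a\<^sup>2 - b\<^sup>2) * (cross2 (M (1, 0)) (M (0, 1)))\<^sup>2"
proof -
  let ?D = "frechet_derivative r (at x)"
  have D: "(r has_derivative ?D) (at x)" using L(3) by (simp add: frechet_derivative_works)
  note DL = bounded_linear.has_derivative[OF L(1) D]
  note comp = bounded_linear.has_derivative[OF bounded_linear_vec_nth DL]
  have LD: "L (?D w) = vector [fst (M w), snd (M w), fst (M w) * a + snd (M w) * b]" for w
  proof -
    have "(\<lambda>w. L (?D w)$1) = (\<lambda>w. fst (M w))"
      by (rule has_derivative_unique[OF comp has_derivative_transform_within_open[OF
              has_derivative_fst[OF assms(1)] N(1,2)]]) (simp add: N(3))
    moreover have "(\<lambda>w. L (?D w)$2) = (\<lambda>w. snd (M w))"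
      by (rule has_derivative_unique[OF comp has_derivative_transform_within_open[OF
              has_derivative_snd[OF assms(1)] N(1,2)]]) (simp add: N(3))
    moreover have "(\<lambda>w. L (?D w)$3) = (\<lambda>w. fst (M w) * a + snd (M w) * b)"
      by (rule has_derivative_unique[OF comp has_derivative_transform_within_open[OF
              diff_chain_at[OF assms(1,2), unfolded o_def] N(1,2)]]) (simp add: N(3))
    ultimately show ?thesis by (simp add: vec_eq_vector_3 fun_eq_iff del: split_paired_All)
  qed
  have "ds2 r x v w = (1 - a\<^sup>2) * (fst (M v) * fst (M w))
      + (- (a * b)) * (fst (M v) * snd (M w) + snd (M v) * fst (M w))
      + (1 - b\<^sup>2) * (snd (M v) * snd (M w))" for v w
  proof -
    have "ds2 r x v w = lorentz (L (?D v)) (L (?D w))" by (simp add: ds2_def L(2))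
    also have "\<dots> = fst (M v) * fst (M w) + snd (M v) * snd (M w)
       - (fst (M v) * a + snd (M v) * b) * (fst (M w) * a + snd (M w) * b)"
      by (simp add: LD lorentz_def)
    finally show ?thesis by (simp add: algebra_simps power2_eq_square)
  qed
  from discriminant_pullback[of r x, OF this]
  have "discriminant r x = ((1 - a\<^sup>2) * (1 - b\<^sup>2) - (- (a * b))\<^sup>2) * (cross2 (M (1, 0)) (M (0, 1)))\<^sup>2" .
  moreover have "(1 - a\<^sup>2) * (1 - b\<^sup>2) - (- (a * b))\<^sup>2 = 1 - a\<^sup>2 - b\<^sup>2"
    by (simp add: algebra_simps power2_eq_square)
  ultimately show ?thesis by simp
qed

text \<open>A Lorentz isometry moves the spacelike tangent vector \<open>e\<close>, normalized, to \<open>(1, 0, 0)\<close> and the null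
  tangent vector \<open>n\<close> to \<open>(0, s, s)\<close>.  The tangent plane is then \<open>z = y\<close>, so the surface is a
  graph with gradient \<open>(0, 1)\<close> at the origin, and the differential of \<open>1 - h\<^sub>x\<^sup>2 - h\<^sub>y\<^sup>2\<close> there is
  \<open>- 2 (h\<^sub>x\<^sub>y, h\<^sub>y\<^sub>y)\<close>.  It annihilates the image of \<open>e\<close>, whence \<open>h\<^sub>x\<^sub>y = 0\<close>, and its value on the
  image of \<open>n\<close> determines \<open>h\<^sub>y\<^sub>y\<close> in terms of \<open>s\<close>.\<close>

lemma lorentz_graph_position:
  fixes r :: "real \<times> real \<Rightarrow> real^3"
  assumes D: "open D" "smooth_on D r" "q \<in> D" "r q = 0" "inj (frechet_derivative r (at q))"
    and n: "n \<in> null_space r q" "n \<noteq> 0" "frechet_derivative (discriminant r) (at q) n \<noteq> 0"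
    and e: "e \<notin> null_space r q" "frechet_derivative (discriminant r) (at q) e = 0"
  obtains L S T P G h where "lorentz_isometry L" "smooth_diffeo S T P G" "S \<subseteq> D" "q \<in> S"
    "P q = (0, 0)" "smooth_on T h" "h (0, 0) = 0"
    "\<forall>x\<in>S. L (r x) = vector [fst (P x), snd (P x), h (P x)]"
    "partial_x h (0, 0) = 0" "partial_y h (0, 0) = 1"
    "partial_x (partial_y h) (0, 0) = 0" "partial_y (partial_y h) (0, 0) = 1 / 2"
proof -
  let ?D = "frechet_derivative r (at q)" and ?d = "frechet_derivative (discriminant r) (at q)"
  note Dr = smooth_on_derivative[OF D(2,3)]
  have linD: "linear ?D" using Dr by (rule has_derivative_linear)
  have Dd: "(discriminant r has_derivative ?d) (at q)"
    by (rule smooth_on_derivative[OF smooth_on_discriminant[OF D(1,2)] D(3)])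
  note frame = tangent_frame_at_lightlike_point[OF differentiableI[OF Dr] D(5) n(1,2) e(1)]

  define e1 where "e1 = inverse (sqrt (lorentz (?D e) (?D e))) *\<^sub>R e"
  define X where "X = cross2 e1 n"
  have De1: "?D e1 = inverse (sqrt (lorentz (?D e) (?D e))) *\<^sub>R ?D e"
    unfolding e1_def by (rule linear_cmul[OF linD])
  have e1: "lorentz (?D e1) (?D e1) = 1" "lorentz (?D e1) (?D n) = 0"
  proof -
    let ?c = "sqrt (lorentz (?D e) (?D e))"
    have "?c * ?c = lorentz (?D e) (?D e)" "?c \<noteq> 0" using frame(4) by simp_all
    then show "lorentz (?D e1) (?D e1) = 1" "lorentz (?D e1) (?D n) = 0"
      using frame(3) unfolding De1 lorentz_scaleR by (auto simp: field_simps)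
  qed
  have de1: "?d e1 = 0"
    unfolding e1_def using linear_cmul[OF has_derivative_linear[OF Dd]] e(2) by simp
  have X: "X \<noteq> 0"
    using frame(4,5) by (auto simp: X_def e1_def cross2_def algebra_simps)

  \<comment> \<open>The null vector is scaled so that \<open>h\<^sub>y\<^sub>y\<close> becomes \<open>1/2\<close>: comparing the two expressions of
    the derivative of the discriminant shows that \<open>- 2 s\<^sup>3 h\<^sub>y\<^sub>y = ?d n * X\<^sup>2\<close>.\<close>
  define s where "s = root 3 (- (?d n * X\<^sup>2))"
  have s3: "s ^ 3 = - (?d n * X\<^sup>2)" unfolding s_def by (simp add: odd_real_root_pow)
  have s0: "s \<noteq> 0"
  proof
    assume "s = 0"
    with s3 X n(3) show False by simp
  qed
  obtain L where L: "linear L" "lorentz_isometry L" "\<And>x y. lorentz (L x) (L y) = lorentz x y"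
    "L (?D e1) = vector [1, 0, 0]" "L (?D n) = vector [0, s, s]"
    using lorentz_frame_exists[OF e1 frame(1,2) s0] by metis
  have bl: "bounded_linear L" using L(1) by (simp add: linear_conv_bounded_linear)

  define \<rho> where "\<rho> x = L (r x)" for x
  have \<rho>: "smooth_on D \<rho>"
    unfolding \<rho>_def[abs_def] by (rule smooth_on_linear_compose[OF D(1) bl D(2)])
  have comp: "smooth_on D (\<lambda>x. \<rho> x $ i)" for i
    by (rule smooth_on_linear_compose[OF D(1) bounded_linear_vec_nth \<rho>])
  have Dcomp: "((\<lambda>x. \<rho> x $ i) has_derivative (\<lambda>w. L (?D w) $ i)) (at q)" for i
    unfolding \<rho>_def
    by (rule bounded_linear.has_derivative[OF bounded_linear_vec_nth bounded_linear.has_derivative[OF bl Dr]])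
  define P where "P x = (\<rho> x $ 1, \<rho> x $ 2)" for x
  define M where "M w = (L (?D w) $ 1, L (?D w) $ 2)" for w
  have sP: "smooth_on D P"
    unfolding P_def[abs_def] by (intro smooth_on_Pair D(1) comp)
  have DP: "(P has_derivative M) (at q)"
    unfolding P_def[abs_def] M_def[abs_def] by (intro has_derivative_Pair Dcomp)
  have linM: "linear M" using DP by (rule has_derivative_linear)
  have M: "M e1 = (1, 0)" "M n = (0, s)" by (simp_all add: M_def L(4,5))
  define J where "J = cross2 (M (1, 0)) (M (0, 1))"
  have JX: "J * X = s"
    using cross2_linear_image[OF linM, of e1 n] by (simp add: J_def X_def M) (simp add: cross2_def)
  have J: "J \<noteq> 0" using JX s0 by auto
  have frP: "frechet_derivative P (at q) = M" by (rule frechet_derivative_eqI[OF DP])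
  have "inj (frechet_derivative P (at q))"
    unfolding frP inj_plane_iff_cross2[OF linM] using J by (simp add: J_def)
  then obtain S T G where G: "smooth_diffeo S T P G" "S \<subseteq> D" "q \<in> S"
    using smooth_inverse_function_plane[OF D(1) sP D(3)] by metis
  have ST: "open S" "open T" "smooth_on T G" "\<And>x. x \<in> S \<Longrightarrow> P x \<in> T \<and> G (P x) = x"
     "\<And>y. y \<in> T \<Longrightarrow> G y \<in> S \<and> P (G y) = y"
    using G(1) by (auto simp: smooth_diffeo_def)
  have "L 0 = 0" by (rule linear_0[OF L(1)])
  then have P0: "P q = (0, 0)" "\<rho> q $ 3 = 0" by (simp_all add: P_def \<rho>_def D(4))
  then have T0: "(0, 0) \<in> T" "G (0, 0) = q" using ST(4)[OF G(3)] by auto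
  define h where "h y = \<rho> (G y) $ 3" for y
  have h: "smooth_on T h"
    unfolding h_def[abs_def] using ST(5) G(2) by (intro smooth_on_compose[OF ST(2) comp ST(3)]) auto
  have graph: "L (r x) = vector [fst (P x), snd (P x), h (P x)]" if "x \<in> S" for x
    using ST(4)[OF that] by (simp add: vec_eq_vector_3 h_def P_def \<rho>_def)
  note sp = smooth_on_partials[OF h]

  have Dz: "(\<lambda>w. L (?D w) $ 3) = (\<lambda>w. fst (M w) * partial_x h (0, 0) + snd (M w) * partial_y h (0, 0))"
  proof (rule has_derivative_unique[OF Dcomp])
    have "((\<lambda>x. h (P x)) has_derivative
        (\<lambda>w. fst (M w) * partial_x h (0, 0) + snd (M w) * partial_y h (0, 0))) (at q)"
      using diff_chain_at[OF DP, of h] has_derivative_partials[OF h T0(1)] P0(1) by (simp add: o_def)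
    then show "((\<lambda>x. \<rho> x $ 3) has_derivative
        (\<lambda>w. fst (M w) * partial_x h (0, 0) + snd (M w) * partial_y h (0, 0))) (at q)"
      by (rule has_derivative_transform_within_open[OF _ ST(1) G(3)]) (simp add: h_def ST(4))
  qed
  have h1: "partial_x h (0, 0) = 0" "partial_y h (0, 0) = 1"
    using fun_cong[OF Dz, of e1] fun_cong[OF Dz, of n] s0 by (simp_all add: M L(4,5))

  let ?\<mu> = "\<lambda>p. 1 - (partial_x h p)\<^sup>2 - (partial_y h p)\<^sup>2"
  have disc: "discriminant r x = ?\<mu> (P x) * (jacobian P x)\<^sup>2" if x: "x \<in> S" for x
  proof -
    have "x \<in> D" using x G(2) by blast
    show ?thesis
      unfolding jacobian_def
      by (rule discriminant_of_graph[OF smooth_on_derivative[OF sP \<open>x \<in> D\<close>]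
            has_derivative_partials[OF h conjunct1[OF ST(4)[OF x]]] bl L(3)
            differentiableI[OF smooth_on_derivative[OF D(2) \<open>x \<in> D\<close>]] ST(1) x graph])
  qed
  have D\<mu>: "(?\<mu> has_derivative (\<lambda>w. - 2 * (fst w * partial_x (partial_y h) (0, 0)
      + snd w * partial_y (partial_y h) (0, 0)))) (at (0, 0))"
  proof -
    note Dx = has_derivative_partials[OF sp(1) T0(1)]
    note Dy = has_derivative_partials[OF sp(2) T0(1)]
    show ?thesis
      using has_derivative_diff[OF has_derivative_diff[OF has_derivative_const[of 1]
            has_derivative_power[OF Dx, of 2]] has_derivative_power[OF Dy, of 2]]
      by (simp add: h1 algebra_simps)
  qed
  have sJ: "smooth_on S (\<lambda>x. (jacobian P x)\<^sup>2)"
    unfolding jacobian_def cross2_def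
    by (intro smooth_on_power[OF ST(1)] smooth_on_diff[OF ST(1)] smooth_on_mult[OF ST(1)]
        smooth_on_fst[OF ST(1)] smooth_on_snd[OF ST(1)] smooth_on_frechet_derivative
        smooth_on_subset[OF sP G(2)])
  have Jq: "jacobian P q = J" by (simp add: jacobian_def frP J_def)
  have "(discriminant r has_derivative (\<lambda>w. ?\<mu> (P q) * frechet_derivative (\<lambda>x. (jacobian P x)\<^sup>2) (at q) w
      + (- 2 * (fst (M w) * partial_x (partial_y h) (0, 0)
      + snd (M w) * partial_y (partial_y h) (0, 0))) * (jacobian P q)\<^sup>2)) (at q)"
  proof (rule has_derivative_transform_within_open[OF _ ST(1) G(3)])
    have "((\<lambda>x. ?\<mu> (P x)) has_derivative (\<lambda>w. - 2 * (fst (M w) * partial_x (partial_y h) (0, 0)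
      + snd (M w) * partial_y (partial_y h) (0, 0)))) (at q)"
      using diff_chain_at[OF DP, of ?\<mu>] D\<mu> P0(1) by (simp add: o_def)
    from has_derivative_mult[OF this smooth_on_derivative[OF sJ G(3)]]
    show "((\<lambda>x. ?\<mu> (P x) * (jacobian P x)\<^sup>2) has_derivative
      (\<lambda>w. ?\<mu> (P q) * frechet_derivative (\<lambda>x. (jacobian P x)\<^sup>2) (at q) w
      + (- 2 * (fst (M w) * partial_x (partial_y h) (0, 0)
      + snd (M w) * partial_y (partial_y h) (0, 0))) * (jacobian P q)\<^sup>2)) (at q)" .
  qed (simp add: disc)
  from frechet_derivative_eqI[OF this]
  have d: "?d w = - 2 * (fst (M w) * partial_x (partial_y h) (0, 0)
      + snd (M w) * partial_y (partial_y h) (0, 0)) * J\<^sup>2" for w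
    by (simp add: P0 h1 Jq)
  have h2: "partial_x (partial_y h) (0, 0) = 0"
    using d[of e1] de1 J by (simp add: M)
  have "- 2 * s ^ 3 * partial_y (partial_y h) (0, 0) = - 2 * s * partial_y (partial_y h) (0, 0) * (J * X)\<^sup>2"
    unfolding JX by (simp add: power2_eq_square power3_eq_cube)
  also have "\<dots> = ?d n * X\<^sup>2"
    unfolding d[of n] by (simp add: M power_mult_distrib)
  also have "\<dots> = - (s ^ 3)" by (simp add: s3)
  finally have "s ^ 3 * (2 * partial_y (partial_y h) (0, 0)) = s ^ 3 * 1" by simp
  then have h3: "partial_y (partial_y h) (0, 0) = 1 / 2"
    using s0 by (simp only: mult_cancel_left) simp
  have "h (0, 0) = 0" by (simp add: h_def T0 P0)
  moreover have "\<forall>x\<in>S. L (r x) = vector [fst (P x), snd (P x), h (P x)]"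
    using graph by blast
  ultimately show ?thesis
    by (rule that[OF L(2) G P0(1) h _ _ h1 h2 h3])
qed

lemma surface_germ_normal_form:
  fixes r :: "real \<times> real \<Rightarrow> real^3"
  assumes D: "open D" "smooth_on D r" "q \<in> D" "r q = 0" "inj (frechet_derivative r (at q))"
    and n: "n \<in> null_space r q" "n \<noteq> 0" "frechet_derivative (discriminant r) (at q) n \<noteq> 0"
    and e: "e \<notin> null_space r q" "frechet_derivative (discriminant r) (at q) e = 0"
  obtains L S E \<psi> \<kappa> I a1 a2 b2 where "lorentz_isometry L" "smooth_diffeo S E \<psi> \<kappa>" "S \<subseteq> D" "q \<in> S"
    "\<psi> q = (0, 0)" "open I" "is_interval I" "\<forall>(u, v)\<in>E. u \<in> I"
    "smooth_on I a1" "smooth_on I a2" "smooth_on E b2" "b2 (0, 0) = 1 / 4"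
    "\<forall>(u, v)\<in>E. L (r (\<kappa> (u, v))) = vector
       [u + u * v * a1 u, v + u\<^sup>2 * a2 u,
        (LBINT t=ereal 0..ereal u. t * (a1 t + 2 * a2 t + t * deriv a2 t) / sqrt (t\<^sup>2 * (a1 t)\<^sup>2 + 1))
        + v * sqrt (u\<^sup>2 * (a1 u)\<^sup>2 + 1) + v\<^sup>2 * b2 (u, v)]"
proof -
  obtain L S0 T P G h where L: "lorentz_isometry L" and P: "smooth_diffeo S0 T P G" "S0 \<subseteq> D" "q \<in> S0"
    "P q = (0, 0)" and h: "smooth_on T h" "h (0, 0) = 0"
    and graph: "\<forall>x\<in>S0. L (r x) = vector [fst (P x), snd (P x), h (P x)]"
    and jet: "partial_x h (0, 0) = 0" "partial_y h (0, 0) = 1"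
    "partial_x (partial_y h) (0, 0) = 0" "partial_y (partial_y h) (0, 0) = 1 / 2"
    by (rule lorentz_graph_position[OF D n e]) (rule that)
  have "P q \<in> T" using P(1,3) unfolding smooth_diffeo_def by blast
  then have T: "open T" "(0, 0) \<in> T" using P(1,4) by (simp_all add: smooth_diffeo_def)
  obtain E T' H K I a1 a2 b2 where H: "smooth_diffeo E T' H K" "(0, 0) \<in> E" "H (0, 0) = (0, 0)" "T' \<subseteq> T"
    and I: "open I" "is_interval I" "\<forall>(u, v)\<in>E. u \<in> I"
    and ab: "smooth_on I a1" "smooth_on I a2" "smooth_on E b2" "b2 (0, 0) = 1 / 4"
    and Hform: "\<forall>(u, v)\<in>E. H (u, v) = (u + u * v * a1 u, v + u\<^sup>2 * a2 u)"
    and hform: "\<forall>(u, v)\<in>E. h (H (u, v)) =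
       (LBINT t=ereal 0..ereal u. t * (a1 t + 2 * a2 t + t * deriv a2 t) / sqrt (t\<^sup>2 * (a1 t)\<^sup>2 + 1))
       + v * sqrt (u\<^sup>2 * (a1 u)\<^sup>2 + 1) + v\<^sup>2 * b2 (u, v)"
    by (rule graph_normal_form[OF T(1) h(1) T(2) h(2) jet]) (rule that)
  have "open T'" using H(1) by (simp add: smooth_diffeo_def)
  have P': "smooth_diffeo (S0 \<inter> P -` T') T' P G"
    by (rule smooth_diffeo_sym[OF smooth_diffeo_restrict[OF smooth_diffeo_sym[OF P(1)] \<open>open T'\<close> H(4)]])
  note \<psi> = smooth_diffeo_compose[OF P' smooth_diffeo_sym[OF H(1)]]
  have "K (0, 0) = (0, 0)" "(0, 0) \<in> T'"
    using H(1-3) unfolding smooth_diffeo_def by metis+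
  then have q: "S0 \<inter> P -` T' \<subseteq> D" "q \<in> S0 \<inter> P -` T'" "K (P q) = (0, 0)"
    using P(2-4) by auto
  have LrGH: "L (r (G (H p))) = vector [fst (H p), snd (H p), h (H p)]" if "p \<in> E" for p
  proof -
    have "H p \<in> T" using that H(1,4) unfolding smooth_diffeo_def by blast
    then have "G (H p) \<in> S0" "P (G (H p)) = H p" using P(1) unfolding smooth_diffeo_def by blast+
    then show ?thesis using graph by simp
  qed
  have "L (r (G (H (u, v)))) = vector
       [u + u * v * a1 u, v + u\<^sup>2 * a2 u,
        (LBINT t=ereal 0..ereal u. t * (a1 t + 2 * a2 t + t * deriv a2 t) / sqrt (t\<^sup>2 * (a1 t)\<^sup>2 + 1))
        + v * sqrt (u\<^sup>2 * (a1 u)\<^sup>2 + 1) + v\<^sup>2 * b2 (u, v)]" if "(u, v) \<in> E" for u v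
    unfolding LrGH[OF that] bspec[OF hform that, unfolded split_conv]
    using bspec[OF Hform that] by simp
  then have "\<forall>(u, v)\<in>E. L (r (G (H (u, v)))) = vector
       [u + u * v * a1 u, v + u\<^sup>2 * a2 u,
        (LBINT t=ereal 0..ereal u. t * (a1 t + 2 * a2 t + t * deriv a2 t) / sqrt (t\<^sup>2 * (a1 t)\<^sup>2 + 1))
        + v * sqrt (u\<^sup>2 * (a1 u)\<^sup>2 + 1) + v\<^sup>2 * b2 (u, v)]"
    by blast
  then show ?thesis
    by (rule that[OF L \<psi> q I ab])
qed


section \<open>Charts of a surface\<close>

lemma is_chartD:
  assumes "is_chart X (U, \<phi>)"
  shows "openin X U" "open (\<phi> ` U)" "inj_on \<phi> U"
    "homeomorphic_map (subtopology X U) (top_of_set (\<phi> ` U)) \<phi>"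
proof -
  show 1: "openin X U" "open (\<phi> ` U)"
    "homeomorphic_map (subtopology X U) (top_of_set (\<phi> ` U)) \<phi>"
    using assms by (simp_all add: is_chart_def)
  have "topspace X \<inter> U = U" using openin_subset[OF 1(1)] by blast
  then show "inj_on \<phi> U"
    using homeomorphic_imp_injective_map[OF 1(3)] by (simp add: topspace_subtopology)
qed

lemma open_chart_image:
  assumes "is_chart X (U, \<phi>)" "openin X N" "N \<subseteq> U"
  shows "open (\<phi> ` N)"
proof -
  note c = is_chartD[OF assms(1)]
  have "openin (subtopology X U) N"
    using assms(2,3) c(1) by (simp add: openin_open_subtopology)
  then have "openin (top_of_set (\<phi> ` U)) (\<phi> ` N)"
    using homeomorphic_map_openness_eq[OF c(4)] by blast
  then show ?thesis using c(2) openin_open_trans by blast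
qed

lemma transition_discriminant:
  assumes surf: "immersed_surface X A f" and c: "(U, \<phi>) \<in> A" and d: "(W, \<omega>) \<in> A"
  defines "\<tau> \<equiv> \<omega> \<circ> inv_into U \<phi>"
  shows "open (\<phi> ` (U \<inter> W))" "smooth_on (\<phi> ` (U \<inter> W)) \<tau>"
    "\<And>x. x \<in> U \<inter> W \<Longrightarrow> \<tau> (\<phi> x) = \<omega> x"
    "\<And>y. y \<in> \<phi> ` (U \<inter> W) \<Longrightarrow> discriminant (f \<circ> inv_into U \<phi>) y
       = discriminant (f \<circ> inv_into W \<omega>) (\<tau> y) * (jacobian \<tau> y)\<^sup>2"
proof -
  have man: "smooth_2_manifold X A" using surf by (simp add: immersed_surface_def)
  have charts: "is_chart X (U, \<phi>)" "is_chart X (W, \<omega>)"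
    using man c d by (auto simp: smooth_2_manifold_def)
  note cU = is_chartD[OF charts(1)] and cW = is_chartD[OF charts(2)]
  show o: "open (\<phi> ` (U \<inter> W))"
    by (rule open_chart_image[OF charts(1) openin_Int[OF cU(1) cW(1)]]) blast
  have "smoothly_compatible (U, \<phi>) (W, \<omega>)"
    using man c d by (auto simp: smooth_2_manifold_def)
  then show s: "smooth_on (\<phi> ` (U \<inter> W)) \<tau>"
    by (simp add: smoothly_compatible_def \<tau>_def)
  show \<tau>: "\<tau> (\<phi> x) = \<omega> x" if "x \<in> U \<inter> W" for x
    using that inv_into_f_f[OF cU(3)] by (simp add: \<tau>_def)
  fix y assume y: "y \<in> \<phi> ` (U \<inter> W)"
  have eq: "(f \<circ> inv_into U \<phi>) z = (f \<circ> inv_into W \<omega>) (\<tau> z)" if z: "z \<in> \<phi> ` (U \<inter> W)" for z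
    using z inv_into_f_f[OF cU(3)] inv_into_f_f[OF cW(3)] by (auto simp: \<tau>_def)
  have "smooth_on (\<omega> ` W) (f \<circ> inv_into W \<omega>)"
    using surf d by (auto simp: immersed_surface_def)
  moreover have "\<tau> y \<in> \<omega> ` W" using y \<tau> by auto
  ultimately have "(f \<circ> inv_into W \<omega>) differentiable (at (\<tau> y))"
    using smooth_on_derivative differentiableI by blast
  from discriminant_reparametrize[OF smooth_on_derivative[OF s y] this o y eq]
  show "discriminant (f \<circ> inv_into U \<phi>) y
       = discriminant (f \<circ> inv_into W \<omega>) (\<tau> y) * (jacobian \<tau> y)\<^sup>2"
    by (simp only: jacobian_def)
qed

lemma discriminant_eq_0_at_lightlike_point:
  assumes surf: "immersed_surface X A f" and c: "(U, \<phi>) \<in> A" and x: "x \<in> U" "x \<in> lightlike_points A f"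
  shows "discriminant (f \<circ> inv_into U \<phi>) (\<phi> x) = 0"
proof -
  obtain W \<omega> where d: "(W, \<omega>) \<in> A" "x \<in> W" "degenerate_at (f \<circ> inv_into W \<omega>) (\<omega> x)"
    using x(2) by (auto simp: lightlike_points_def)
  have "smooth_on (\<omega> ` W) (f \<circ> inv_into W \<omega>)"
    using surf d(1) by (auto simp: immersed_surface_def)
  then have "(f \<circ> inv_into W \<omega>) differentiable (at (\<omega> x))"
    using smooth_on_derivative differentiableI d(2) by blast
  then have "discriminant (f \<circ> inv_into W \<omega>) (\<omega> x) = 0"
    using d(3) degenerate_at_iff_discriminant by blast
  then show ?thesis
    using transition_discriminant(3,4)[OF surf c d(1)] x(1) d(2) by auto
qed

text \<open>At a lightlike point the discriminant vanishes, so its differential is merely multiplied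
  by the squared Jacobian of a change of charts; non-degeneracy therefore holds in one chart
  exactly if it holds in every chart.\<close>

lemma discriminant_derivative_nonzero_in_all_charts:
  assumes surf: "immersed_surface X A f" and c: "(U, \<phi>) \<in> A" "p \<in> U"
    and p: "nondegenerate_lightlike A f p"
  shows "frechet_derivative (discriminant (f \<circ> inv_into U \<phi>)) (at (\<phi> p)) \<noteq> (\<lambda>_. 0)"
proof
  let ?r = "f \<circ> inv_into U \<phi>"
  assume 0: "frechet_derivative (discriminant ?r) (at (\<phi> p)) = (\<lambda>_. 0)"
  obtain W \<omega> where d: "(W, \<omega>) \<in> A" "p \<in> W"
    and nz: "frechet_derivative (discriminant (f \<circ> inv_into W \<omega>)) (at (\<omega> p)) \<noteq> (\<lambda>_. 0)"
    using p by (auto simp: nondegenerate_lightlike_def)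
  have light: "p \<in> lightlike_points A f" using p by (simp add: nondegenerate_lightlike_def)
  let ?\<tau> = "\<phi> \<circ> inv_into W \<omega>" and ?N = "\<omega> ` (W \<inter> U)"
  note tr = transition_discriminant[OF surf d(1) c(1)]
  have pN: "\<omega> p \<in> ?N" "?\<tau> (\<omega> p) = \<phi> p" using c(2) d(2) tr(3) by auto
  have "is_chart X (U, \<phi>)" "smooth_on (\<phi> ` U) ?r"
    using surf c(1) by (auto simp: immersed_surface_def smooth_2_manifold_def)
  then have "smooth_on (\<phi> ` U) (discriminant ?r)"
    using smooth_on_discriminant is_chartD(2) by blast
  then have "(discriminant ?r has_derivative (\<lambda>_. 0)) (at (?\<tau> (\<omega> p)))"
    using smooth_on_derivative c(2) 0 pN(2) by (metis imageI)
  from diff_chain_at[OF smooth_on_derivative[OF tr(2) pN(1)] this]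
  have Dd: "((\<lambda>y. discriminant ?r (?\<tau> y)) has_derivative (\<lambda>_. 0)) (at (\<omega> p))"
    by (simp add: o_def)
  have "smooth_on ?N (\<lambda>y. (jacobian ?\<tau> y)\<^sup>2)"
    unfolding jacobian_def cross2_def
    by (intro smooth_on_power smooth_on_diff smooth_on_mult smooth_on_fst smooth_on_snd
        smooth_on_frechet_derivative tr(1,2))
  from has_derivative_mult[OF Dd smooth_on_derivative[OF this pN(1)]]
  have "((\<lambda>y. discriminant ?r (?\<tau> y) * (jacobian ?\<tau> y)\<^sup>2) has_derivative (\<lambda>_. 0)) (at (\<omega> p))"
    using discriminant_eq_0_at_lightlike_point[OF surf c light] pN(2) by simp
  then have "(discriminant (f \<circ> inv_into W \<omega>) has_derivative (\<lambda>_. 0)) (at (\<omega> p))"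
    by (rule has_derivative_transform_within_open[OF _ tr(1) pN(1)]) (simp add: tr(4))
  with nz show False using frechet_derivative_eqI by blast
qed

lemma coordinate_chart_compose_diffeo:
  assumes man: "smooth_2_manifold X A" and c: "(U, \<phi>) \<in> A"
    and \<psi>: "smooth_diffeo S E \<psi> \<kappa>" "S \<subseteq> \<phi> ` U"
  defines "N \<equiv> inv_into U \<phi> ` S"
  shows "coordinate_chart X A (N, \<psi> \<circ> \<phi>)" "(\<psi> \<circ> \<phi>) ` N = E"
    "\<And>y. y \<in> E \<Longrightarrow> inv_into N (\<psi> \<circ> \<phi>) y = inv_into U \<phi> (\<kappa> y)"
    "\<And>x. x \<in> U \<Longrightarrow> \<phi> x \<in> S \<Longrightarrow> x \<in> N"
proof -
  have chart: "is_chart X (U, \<phi>)" using man c by (auto simp: smooth_2_manifold_def)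
  note cU = is_chartD[OF chart]
  have D: "open S" "open E" "smooth_on S \<psi>" "smooth_on E \<kappa>"
    "\<And>x. x \<in> S \<Longrightarrow> \<psi> x \<in> E \<and> \<kappa> (\<psi> x) = x" "\<And>y. y \<in> E \<Longrightarrow> \<kappa> y \<in> S \<and> \<psi> (\<kappa> y) = y"
    using \<psi>(1) by (auto simp: smooth_diffeo_def)
  have inv: "inv_into U \<phi> (\<phi> x) = x" if "x \<in> U" for x using inv_into_f_f[OF cU(3) that] .
  have N3: "N = U \<inter> \<phi> -` S"
  proof
    show "N \<subseteq> U \<inter> \<phi> -` S"
      using \<psi>(2) by (auto simp: N_def subset_iff inv_into_into f_inv_into_f)
    show "U \<inter> \<phi> -` S \<subseteq> N"
      unfolding N_def using inv by (metis Int_iff image_eqI subsetI vimageE)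
  qed
  then have N: "N \<subseteq> U" "\<phi> ` N = S" "N = U \<inter> \<phi> -` S" using \<psi>(2) by auto
  show NI: "x \<in> N" if "x \<in> U" "\<phi> x \<in> S" for x using that N(3) by blast
  show im: "(\<psi> \<circ> \<phi>) ` N = E"
    unfolding image_comp[symmetric] N(2) using D(5,6) by (auto simp: image_iff) metis
  have inj: "inj_on (\<psi> \<circ> \<phi>) N"
  proof (rule comp_inj_on)
    show "inj_on \<phi> N" using cU(3) N(1) inj_on_subset by blast
    show "inj_on \<psi> (\<phi> ` N)" unfolding N(2) using D(5) by (metis inj_onI)
  qed
  show iv: "inv_into N (\<psi> \<circ> \<phi>) y = inv_into U \<phi> (\<kappa> y)" if y: "y \<in> E" for y
  proof (rule inv_into_f_eq[OF inj])
    have y': "\<kappa> y \<in> S" "\<psi> (\<kappa> y) = y" using D(6)[OF y] by auto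
    moreover have "\<kappa> y \<in> \<phi> ` U" using y'(1) \<psi>(2) by blast
    ultimately show "inv_into U \<phi> (\<kappa> y) \<in> N" "(\<psi> \<circ> \<phi>) (inv_into U \<phi> (\<kappa> y)) = y"
      by (simp_all add: N_def f_inv_into_f)
  qed
  have sub: "openin (subtopology X U) N"
  proof -
    have "openin (top_of_set (\<phi> ` U)) S" using D(1) \<psi>(2) by (simp add: open_subset)
    moreover have "N \<subseteq> topspace (subtopology X U)"
      using N(1) openin_subset[OF cU(1)] by auto
    ultimately show ?thesis
      using homeomorphic_map_openness[OF cU(4), of N] N(2) by simp
  qed
  have oN: "openin X N" using sub cU(1) by (simp add: openin_open_subtopology)
  have "homeomorphic_map (subtopology X N) (top_of_set S) \<phi>"
  proof -
    have "homeomorphic_map (subtopology (subtopology X U) N) (subtopology (top_of_set (\<phi> ` U)) S) \<phi>"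
      using N openin_subset[OF oN] D(1) \<psi>(2)
      by (intro homeomorphic_map_subtopologies[OF cU(4)]) auto
    moreover have "U \<inter> N = N" "\<phi> ` U \<inter> S = S" using N(1) \<psi>(2) by blast+
    ultimately show ?thesis by (simp add: subtopology_subtopology)
  qed
  moreover have "homeomorphic_map (top_of_set S) (top_of_set E) \<psi>"
  proof -
    have "homeomorphism S E \<psi> \<kappa>"
      using D smooth_on_imp_continuous_on by (intro homeomorphismI) auto
    then show ?thesis
      unfolding homeomorphic_map_maps homeomorphic_maps_def homeomorphism_def by auto
  qed
  ultimately have "homeomorphic_map (subtopology X N) (top_of_set E) (\<psi> \<circ> \<phi>)"
    by (rule homeomorphic_map_compose)
  then have chartN: "is_chart X (N, \<psi> \<circ> \<phi>)"
    using oN D(2) im by (simp add: is_chart_def)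
  moreover have "smoothly_compatible (N, \<psi> \<circ> \<phi>) (W, \<omega>)" if d: "(W, \<omega>) \<in> A" for W \<omega>
  proof -
    have chartW: "is_chart X (W, \<omega>)" and "smoothly_compatible (U, \<phi>) (W, \<omega>)"
      using man c d by (auto simp: smooth_2_manifold_def)
    note cW = is_chartD[OF chartW]
    have comp: "smooth_on (\<phi> ` (U \<inter> W)) (\<omega> \<circ> inv_into U \<phi>)"
      "smooth_on (\<omega> ` (U \<inter> W)) (\<phi> \<circ> inv_into W \<omega>)"
      using \<open>smoothly_compatible (U, \<phi>) (W, \<omega>)\<close> by (simp_all add: smoothly_compatible_def)
    have NW: "openin X (N \<inter> W)" using oN cW(1) by (rule openin_Int)
    let ?M = "(\<psi> \<circ> \<phi>) ` (N \<inter> W)"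
    have oM: "open ?M" by (rule open_chart_image[OF chartN NW]) blast
    have M: "\<kappa> y \<in> \<phi> ` (U \<inter> W)" "y \<in> E" if y: "y \<in> ?M" for y
    proof -
      obtain x where x: "x \<in> N" "x \<in> W" "y = \<psi> (\<phi> x)" using y by auto
      then have "\<phi> x \<in> S" "x \<in> U" using N by auto
      then show "\<kappa> y \<in> \<phi> ` (U \<inter> W)" "y \<in> E" using x D(5) by auto
    qed
    have "smooth_on ?M (\<lambda>y. (\<omega> \<circ> inv_into U \<phi>) (\<kappa> y))"
      by (rule smooth_on_compose[OF oM comp(1) smooth_on_subset[OF D(4) subsetI[OF M(2)]]
            image_subsetI[OF M(1)]])
    then have "smooth_on ?M (\<omega> \<circ> inv_into N (\<psi> \<circ> \<phi>))"
      by (rule smooth_on_open_cong[OF oM]) (use M(2) iv in simp)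
    moreover have "smooth_on (\<omega> ` (N \<inter> W)) ((\<psi> \<circ> \<phi>) \<circ> inv_into W \<omega>)"
    proof -
      have "open (\<omega> ` (N \<inter> W))" by (rule open_chart_image[OF chartW NW]) blast
      moreover have "smooth_on (\<omega> ` (N \<inter> W)) (\<phi> \<circ> inv_into W \<omega>)"
        by (rule smooth_on_subset[OF comp(2)]) (use N(1) in blast)
      moreover have "(\<phi> \<circ> inv_into W \<omega>) ` \<omega> ` (N \<inter> W) \<subseteq> S"
        using N(2) inv_into_f_f[OF cW(3)] by auto
      ultimately show ?thesis
        using smooth_on_compose[OF _ D(3)] by (simp add: o_def)
    qed
    ultimately show ?thesis by (simp add: smoothly_compatible_def)
  qed
  ultimately show "coordinate_chart X A (N, \<psi> \<circ> \<phi>)"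
    by (auto simp: coordinate_chart_def)
qed


section \<open>The normal form\<close>

text \<open>The discriminant vanishes along the lightlike curve, so its differential annihilates the
  tangent \<open>e\<close> of the curve.  As \<open>e\<close> and the null vector \<open>n\<close> form a basis and the differential is
  not zero, it cannot annihilate \<open>n\<close>.\<close>

lemma first_kind_frame:
  assumes surf: "immersed_surface X A f" and kind: "lightlike_first_kind X A f p"
  obtains U \<phi> n e where "(U, \<phi>) \<in> A" "p \<in> U"
    "n \<in> null_space (f \<circ> inv_into U \<phi>) (\<phi> p)" "n \<noteq> 0"
    "frechet_derivative (discriminant (f \<circ> inv_into U \<phi>)) (at (\<phi> p)) n \<noteq> 0"
    "e \<notin> null_space (f \<circ> inv_into U \<phi>) (\<phi> p)"
    "frechet_derivative (discriminant (f \<circ> inv_into U \<phi>)) (at (\<phi> p)) e = 0"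
proof -
  obtain U \<phi> W \<epsilon> \<gamma> where c: "(U, \<phi>) \<in> A" "p \<in> U"
    and \<gamma>: "W \<subseteq> U" "\<epsilon> > 0" "\<gamma> 0 = p" "\<gamma> ` {-\<epsilon><..<\<epsilon>} = lightlike_points A f \<inter> W"
      "smooth_on {-\<epsilon><..<\<epsilon>} (\<phi> \<circ> \<gamma>)"
      "vector_derivative (\<phi> \<circ> \<gamma>) (at 0) \<notin> null_space (f \<circ> inv_into U \<phi>) (\<phi> p)"
    using kind by (auto simp: lightlike_first_kind_def)
  have nondeg: "nondegenerate_lightlike A f p" using kind by (simp add: lightlike_first_kind_def)
  then have light: "p \<in> lightlike_points A f" by (simp add: nondegenerate_lightlike_def)
  let ?r = "f \<circ> inv_into U \<phi>" and ?e = "vector_derivative (\<phi> \<circ> \<gamma>) (at 0)"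
  let ?d = "frechet_derivative (discriminant ?r) (at (\<phi> p))"
  have chart: "is_chart X (U, \<phi>)" and r: "smooth_on (\<phi> ` U) ?r" "\<phi> p \<in> \<phi> ` U"
    "inj (frechet_derivative ?r (at (\<phi> p)))"
    using surf c by (auto simp: immersed_surface_def smooth_2_manifold_def)
  have diff: "?r differentiable (at (\<phi> p))"
    using smooth_on_derivative[OF r(1,2)] by (rule differentiableI)
  have Dd: "(discriminant ?r has_derivative ?d) (at (\<phi> p))"
    by (rule smooth_on_derivative[OF smooth_on_discriminant[OF is_chartD(2)[OF chart] r(1)] r(2)])
  obtain n where n: "n \<in> null_space ?r (\<phi> p)" "n \<noteq> 0"
    using discriminant_eq_0_at_lightlike_point[OF surf c light] degenerate_at_iff_discriminant[OF diff]
    unfolding degenerate_at_def by blast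
  have e: "?d ?e = 0"
  proof -
    have "(\<phi> \<circ> \<gamma>) differentiable (at 0)"
      using smooth_on_derivative[OF \<gamma>(5), of 0] \<gamma>(2) by (auto intro: differentiableI)
    then have "((\<phi> \<circ> \<gamma>) has_vector_derivative ?e) (at 0)"
      by (simp add: vector_derivative_works)
    then have "((\<phi> \<circ> \<gamma>) has_derivative (\<lambda>h. h *\<^sub>R ?e)) (at 0)"
      by (simp add: has_vector_derivative_def)
    from diff_chain_at[OF this, of "discriminant ?r" ?d] Dd \<gamma>(3)
    have 1: "((\<lambda>t. discriminant ?r (\<phi> (\<gamma> t))) has_derivative (\<lambda>h. ?d (h *\<^sub>R ?e))) (at 0)"
      by (simp add: o_def)
    have 0: "discriminant ?r (\<phi> (\<gamma> t)) = 0" if "t \<in> {-\<epsilon><..<\<epsilon>}" for t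
    proof -
      have "\<gamma> t \<in> lightlike_points A f" "\<gamma> t \<in> U" using that \<gamma>(1,4) by blast+
      then show ?thesis using discriminant_eq_0_at_lightlike_point[OF surf c(1)] by blast
    qed
    have 2: "((\<lambda>t. discriminant ?r (\<phi> (\<gamma> t))) has_derivative (\<lambda>h. 0)) (at 0)"
      by (rule has_derivative_transform_within_open[OF has_derivative_const[of 0] open_greaterThanLessThan])
         (use \<gamma>(2) 0 in auto)
    show ?thesis using fun_cong[OF has_derivative_unique[OF 1 2], of 1] by simp
  qed
  have "?d n \<noteq> 0"
  proof
    assume dn: "?d n = 0"
    have lin: "linear ?d" using Dd by (rule has_derivative_linear)
    have X: "cross2 ?e n \<noteq> 0"
      using tangent_frame_at_lightlike_point(5)[OF diff r(3) n \<gamma>(6)] .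
    have "?d v = 0" for v
    proof -
      have "cross2 ?e n * ?d v = cross2 v n * ?d ?e + cross2 ?e v * ?d n"
        by (metis cross2_expand linear_add[OF lin] linear_cmul[OF lin] real_scaleR_def)
      then show ?thesis using X e dn by simp
    qed
    then show False
      using discriminant_derivative_nonzero_in_all_charts[OF surf c nondeg] by blast
  qed
  then show ?thesis using that[OF c n _ \<gamma>(6) e] by blast
qed

theorem proposition6p1:
  fixes X :: "'a topology" and A :: "'a chart set" and f :: "'a \<Rightarrow> real^3" and p :: 'a
  assumes "mixed_type_surface X A f"
    and "p \<in> topspace X"
    and "lightlike_first_kind X A f p"
    and "f p = 0"
  shows "\<exists>(U :: 'a set) (\<psi> :: 'a \<Rightarrow> real \<times> real) (V :: (real^3) set) (\<Psi> :: real^3 \<Rightarrow> real^3)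
      (I :: real set) (a1 :: real \<Rightarrow> real) (a2 :: real \<Rightarrow> real) (a3 :: real \<Rightarrow> real)
      (b1 :: real \<times> real \<Rightarrow> real) (b2 :: real \<times> real \<Rightarrow> real).
      coordinate_chart X A (U, \<psi>) \<and> p \<in> U \<and> \<psi> p = (0, 0) \<and>
      open V \<and> 0 \<in> V \<and> f ` U \<subseteq> V \<and> lorentz_motion_on V \<Psi> \<and>
      open I \<and> is_interval I \<and> (\<forall>(u, v)\<in>\<psi> ` U. u \<in> I) \<and>
      smooth_on I a1 \<and> smooth_on I a2 \<and> smooth_on I a3 \<and>
      smooth_on (\<psi> ` U) b1 \<and> smooth_on (\<psi> ` U) b2 \<and>
      b2 (0, 0) = 1 / 4 \<and>
      (\<forall>(u, v)\<in>\<psi> ` U. \<Psi> (f (inv_into U \<psi> (u, v))) = vector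
         [u + u * v * a1 u + u * v\<^sup>2 * a3 u + v ^ 3 * b1 (u, v),
          v + u\<^sup>2 * a2 u,
          (LBINT t=ereal 0..ereal u.
             t * (a1 t + 2 * a2 t + t * deriv a2 t) / sqrt (t\<^sup>2 * (a1 t)\<^sup>2 + 1))
          + v * sqrt (u\<^sup>2 * (a1 u)\<^sup>2 + 1) + v\<^sup>2 * b2 (u, v)])"
proof -
  have surf: "immersed_surface X A f" using assms(1) by (simp add: mixed_type_surface_def)
  then have man: "smooth_2_manifold X A" by (simp add: immersed_surface_def)
  obtain U \<phi> n e where c: "(U, \<phi>) \<in> A" "p \<in> U"
    and n: "n \<in> null_space (f \<circ> inv_into U \<phi>) (\<phi> p)" "n \<noteq> 0"
      "frechet_derivative (discriminant (f \<circ> inv_into U \<phi>)) (at (\<phi> p)) n \<noteq> 0"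
    and e: "e \<notin> null_space (f \<circ> inv_into U \<phi>) (\<phi> p)"
      "frechet_derivative (discriminant (f \<circ> inv_into U \<phi>)) (at (\<phi> p)) e = 0"
    by (rule first_kind_frame[OF surf assms(3)])
  let ?r = "f \<circ> inv_into U \<phi>"
  have chart: "is_chart X (U, \<phi>)" and r: "smooth_on (\<phi> ` U) ?r" "\<phi> p \<in> \<phi> ` U"
    "inj (frechet_derivative ?r (at (\<phi> p)))"
    using surf c by (auto simp: immersed_surface_def smooth_2_manifold_def)
  have "?r (\<phi> p) = 0" using inv_into_f_f[OF is_chartD(3)[OF chart] c(2)] assms(4) by simp
  then obtain L S E \<psi> \<kappa> I a1 a2 b2 where L: "lorentz_isometry L"
    and \<psi>: "smooth_diffeo S E \<psi> \<kappa>" "S \<subseteq> \<phi> ` U" "\<phi> p \<in> S" "\<psi> (\<phi> p) = (0, 0)"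
    and I: "open I" "is_interval I" "\<forall>(u, v)\<in>E. u \<in> I"
    and ab: "smooth_on I a1" "smooth_on I a2" "smooth_on E b2" "b2 (0, 0) = 1 / 4"
    and form: "\<forall>(u, v)\<in>E. L (?r (\<kappa> (u, v))) = vector
       [u + u * v * a1 u, v + u\<^sup>2 * a2 u,
        (LBINT t=ereal 0..ereal u. t * (a1 t + 2 * a2 t + t * deriv a2 t) / sqrt (t\<^sup>2 * (a1 t)\<^sup>2 + 1))
        + v * sqrt (u\<^sup>2 * (a1 u)\<^sup>2 + 1) + v\<^sup>2 * b2 (u, v)]"
    by (rule surface_germ_normal_form[OF is_chartD(2)[OF chart] r(1,2) _ r(3) n e]) (rule that)
  define N where "N = inv_into U \<phi> ` S"
  note N = coordinate_chart_compose_diffeo[OF man c(1) \<psi>(1,2), folded N_def]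
  have motion: "lorentz_motion_on UNIV L" using L by (auto simp: lorentz_motion_on_def)
  have "L (f (inv_into N (\<psi> \<circ> \<phi>) (u, v))) = vector
         [u + u * v * a1 u + u * v\<^sup>2 * 0 + v ^ 3 * 0, v + u\<^sup>2 * a2 u,
          (LBINT t=ereal 0..ereal u. t * (a1 t + 2 * a2 t + t * deriv a2 t) / sqrt (t\<^sup>2 * (a1 t)\<^sup>2 + 1))
          + v * sqrt (u\<^sup>2 * (a1 u)\<^sup>2 + 1) + v\<^sup>2 * b2 (u, v)]" if "(u, v) \<in> E" for u v
    unfolding N(3)[OF that] using bspec[OF form that] by simp
  then have form': "\<forall>(u, v)\<in>E. L (f (inv_into N (\<psi> \<circ> \<phi>) (u, v))) = vector
         [u + u * v * a1 u + u * v\<^sup>2 * 0 + v ^ 3 * 0, v + u\<^sup>2 * a2 u,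
          (LBINT t=ereal 0..ereal u. t * (a1 t + 2 * a2 t + t * deriv a2 t) / sqrt (t\<^sup>2 * (a1 t)\<^sup>2 + 1))
          + v * sqrt (u\<^sup>2 * (a1 u)\<^sup>2 + 1) + v\<^sup>2 * b2 (u, v)]"
    by blast
  show ?thesis
    by (intro exI[of _ N] exI[of _ "\<psi> \<circ> \<phi>"] exI[of _ UNIV] exI[of _ L] exI[of _ I]
        exI[of _ a1] exI[of _ a2] exI[of _ "\<lambda>_. 0"] exI[of _ "\<lambda>_. 0"] exI[of _ b2] conjI, unfold N(2))
       (rule N(1) N(4)[OF c(2) \<psi>(3)] open_UNIV UNIV_I subset_UNIV motion I ab smooth_on_const form'
         | simp add: \<psi>(4))+
qed

end
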